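(* Let $(\mathcal{B},\mathbb{C},F,\mathbb{H})$ be a geminal category, with $\Box=\gamma_{\mathbb C}\circ F$. For any object $A\in\mathcal{B}$, there exists a morphism $Y_A:\mathbb{C}(F\Box A,FA)\to\Box A$ in $\mathcal B$ such that $$Y_A=\circ_{\mathbb C}\circ\langle \mathbb{H}_{1_{\mathbb C},FA}\circ Y_A,\ \mathrm{id}\rangle,$$ where $\langle \mathbb{H}_{1_{\mathbb C},FA}\circ Y_A,\mathrm{id}\rangle:\mathbb C(F\Box A,FA)\to\mathbb C(1_{\mathbb C},F\Box A)\times\mathbb C(F\Box A,FA)$, the morphism $\circ_{\mathbb C}:\mathbb C(1_{\mathbb C},F\Box A)\times\mathbb C(F\Box A,FA)\to\mathbb C(1_{\mathbb C},FA)=\Box A$ is composition in $\mathbb C$, and $\mathbb H_{1_{\mathbb C},FA}$ is regarded as a morphism $\Box A=\mathbb C(1_{\mathbb C},FA)\to(\Box\mathbb C)(\mathbb H1_{\mathbb C},\mathbb HFA)\cong\Box(\mathbb C(1_{\mathbb C},FA))=\Box\Box A=\mathbb C(1_{\mathbb C},F\Box A)$ via the canonical isomorphism.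
   Context: Internal categories. Let $\mathcal B$ be a locally small category with finite limits (a terminal object $1$ and pullbacks). A $\mathcal B$-internal category $\mathbb C$ has an object of objects $|\mathbb C|$, an object of morphisms $|\mathbb C^{\to}|$, morphisms $\mathrm{dom},\mathrm{cod}:|\mathbb C^\to|\to|\mathbb C|$, identities $e:|\mathbb C|\to|\mathbb C^\to|$ and a composition $\circ$ defined on the object of composable pairs (written in diagrammatic order), satisfying the usual axioms. An internal functor $\mathbb H:\mathbb C\to\mathbb D$ is a pair $|\mathbb H|:|\mathbb C|\to|\mathbb D|$, $|\mathbb H^\to|:|\mathbb C^\to|\to|\mathbb D^\to|$ commuting with this structure. A global object $X\in_1\mathbb C$ is a morphism $X:1\to|\mathbb C|$; $\mathbb HX=|\mathbb H|\circ X$. The hom-object $\mathbb C(X,Y)$ is the pullback of $\langle\mathrm{dom},\mathrm{cod}\rangle:|\mathbb C^\to|\to|\mathbb C|\times|\mathbb C|$ along $\langle X,Y\rangle:1\to|\mathbb C|\times|\mathbb C|$; its global elements (morphisms from $1$) are identified with global elements of $|\mathbb C^\to|$ with domain $X$ and codomain $Y$. Composition induces $\circ_{\mathbb C}:\mathbb C(X,Y)\times\mathbb C(Y,Z)\to\mathbb C(X,Z)$ and $\mathbb H$ induces $\mathbb H_{X,Y}:\mathbb C(X,Y)\to\mathbb D(\mathbb HX,\mathbb HY)$. The underlying category $\Gamma\mathbb C$ has global objects as objects and global elements of $\mathbb C(X,Y)$ as morphisms $X\to Y$; $\mathbb H$ induces a functor $\Gamma\mathbb H$. $\mathbb C$ has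 chosen finite limits if it is equipped with an internal chosen terminal object $1_{\mathbb C}\in_1\mathbb C$ and internal chosen pullbacks (given by morphisms of $\mathcal B$ expressing a choice of pullback squares and of mediating arrows, satisfying the evident internal equations); then $\Gamma\mathbb C$ has induced chosen finite limits. The global section functor is $\gamma_{\mathbb C}=\mathbb C(1_{\mathbb C},-):\Gamma\mathbb C\to\mathcal B$ (acting on morphisms by $\circ_{\mathbb C}$); it preserves finite limits. If $G:\mathcal B\to\mathcal B'$ preserves finite limits, $G\mathbb C$ is the $\mathcal B'$-internal category obtained by applying $G$ to all data of $\mathbb C$ (with induced chosen finite limits), $G\mathbb H$ is defined similarly for internal functors, and $G^{\#}_{\mathbb C}:\Gamma\mathbb C\to\Gamma G\mathbb C$ is the functor sending a global object $X$ to $1\cong G1\xrightarrow{GX}G|\mathbb C|$, and likewise on global morphisms; canonically $(G\mathbb C)(G^\#X,G^\#Y)\cong G(\mathbb C(X,Y))$. Pre-geminal category. It consists of: (I) a category $\mathcal B$ with chosen finite limits; (II) a $\mathcal B$-internal category $\mathbb C$ with chosen finite limits; (III) a functor $F:\mathcal B\to\Gamma\mathbb C$ strictly preserving the chosen finite limits; put $\Box=\gamma_{\mathbb C}\circ F:\mathcal B\to\mathcal B$, so $\Box A=\mathbb C(1_{\mathbb C},FA)$ (it preserves finite limits); (IV) a $\mathcal B$-internal functor $\mathbb H:\mathbb C\to\Box\mathbb C$ satisfying $\Gamma\mathbb H\circ F=F^{\#}_{\mathbb C}\circ F$, where the codomain $\Gamma F\mathbb C$ of $F^\#_{\mathbb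 C}$ is identified with $\Gamma\Box\mathbb C=\Gamma\gamma_{\mathbb C}F\mathbb C$ by the canonical isomorphism. Unfolded: with $u:1\cong\Box1$ the unique isomorphism, $|\mathbb H|\circ FA=\Box(FA)\circ u$ for every object $A$ of $\mathcal B$, and $|\mathbb H^\to|\circ Ff=\Box(Ff)\circ u$ for every morphism $f$ of $\mathcal B$, where $FA:1\to|\mathbb C|$ and $Ff:1\to|\mathbb C^\to|$. In particular $\mathbb HFA=\Box^\#FA$, whence a canonical isomorphism $(\Box\mathbb C)(\mathbb HFA,\mathbb HFB)\cong\Box(\mathbb C(FA,FB))$ for all $A,B\in\mathcal B$ (and $F1=1_{\mathbb C}$). Geminal category. It is a pre-geminal category such that $\mathbb H$ strictly preserves the chosen finite limits and $\Box\mathbb H\circ\mathbb H=\mathbb H^{\#}_{F\mathbb C}\circ\mathbb H$ as internal functors $\mathbb C\to\Box\Box\mathbb C$. Here $\mathbb H^\#_{F\mathbb C}:\Box\mathbb C=\gamma_{\mathbb C}F\mathbb C\to\Box\Box\mathbb C$ is the $\mathcal B$-internal functor given on objects by $\sigma_{|\mathbb C|}:\Box|\mathbb C|\to\Box\Box|\mathbb C|$ and on morphisms by $\sigma_{|\mathbb C^\to|}:\Box|\mathbb C^\to|\to\Box\Box|\mathbb C^\to|$, where for $A\in\mathcal B$, $\sigma_A$ is the composite $\Box A=\mathbb C(1_{\mathbb C},FA)\xrightarrow{\mathbb H_{1_{\mathbb C},FA}}(\Box\mathbb C)(\mathbb H1_{\mathbb C},\mathbb HFA)\cong\Box(\mathbb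 C(1_{\mathbb C},FA))=\Box\Box A$. *)

theory Defs
  imports Main
begin

section \<open>Categories, chosen finite limits and functors\<close>

text \<open>
  Composition is written in applicative order: \<open>g \<cdot>\<^bsub>B\<^esub> f\<close> is "first \<open>f\<close>, then \<open>g\<close>".
  Values of the operations outside the carriers are unconstrained. Arrows belong to one HOL
  type, so every category considered here is locally small.
\<close>

record ('o, 'm) category =
  Obj :: "'o set"
  Arr :: "'m set"
  Dom :: "'m \<Rightarrow> 'o"
  Cod :: "'m \<Rightarrow> 'o"
  Idn :: "'o \<Rightarrow> 'm"
  Comp :: "'m \<Rightarrow> 'm \<Rightarrow> 'm" (infixr "\<cdot>\<index>" 75)

definition hom :: "('o, 'm, 'z) category_scheme \<Rightarrow> 'o \<Rightarrow> 'o \<Rightarrow> 'm set" where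
  "hom B X Y = {f \<in> Arr B. Dom B f = X \<and> Cod B f = Y}"

definition is_category :: "('o, 'm, 'z) category_scheme \<Rightarrow> bool" where
  "is_category B \<longleftrightarrow>
     (\<forall>f \<in> Arr B. Dom B f \<in> Obj B \<and> Cod B f \<in> Obj B) \<and>
     (\<forall>X \<in> Obj B. Idn B X \<in> hom B X X) \<and>
     (\<forall>f \<in> Arr B. \<forall>g \<in> Arr B. Cod B f = Dom B g \<longrightarrow>
        g \<cdot>\<^bsub>B\<^esub> f \<in> hom B (Dom B f) (Cod B g)) \<and>
     (\<forall>f \<in> Arr B. f \<cdot>\<^bsub>B\<^esub> Idn B (Dom B f) = f \<and> Idn B (Cod B f) \<cdot>\<^bsub>B\<^esub> f = f) \<and>
     (\<forall>f \<in> Arr B. \<forall>g \<in> Arr B. \<forall>h \<in> Arr B. Cod B f = Dom B g \<longrightarrow> Cod B g = Dom B h \<longrightarrow>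
        h \<cdot>\<^bsub>B\<^esub> (g \<cdot>\<^bsub>B\<^esub> f) = (h \<cdot>\<^bsub>B\<^esub> g) \<cdot>\<^bsub>B\<^esub> f)"

definition is_terminal :: "('o, 'm, 'z) category_scheme \<Rightarrow> 'o \<Rightarrow> bool" where
  "is_terminal B t \<longleftrightarrow> t \<in> Obj B \<and> (\<forall>X \<in> Obj B. \<exists>!f. f \<in> hom B X t)"

text \<open>\<open>p\<close> and \<open>q\<close> are the projections of a pullback of \<open>f\<close> and \<open>g\<close>: \<open>f \<cdot> p = g \<cdot> q\<close>.\<close>

definition is_pullback :: "('o, 'm, 'z) category_scheme \<Rightarrow> 'm \<Rightarrow> 'm \<Rightarrow> 'm \<Rightarrow> 'm \<Rightarrow> bool" where
  "is_pullback B f g p q \<longleftrightarrow>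
     f \<in> Arr B \<and> g \<in> Arr B \<and> Cod B f = Cod B g \<and>
     p \<in> hom B (Dom B p) (Dom B f) \<and> q \<in> hom B (Dom B p) (Dom B g) \<and>
     f \<cdot>\<^bsub>B\<^esub> p = g \<cdot>\<^bsub>B\<^esub> q \<and>
     (\<forall>T \<in> Obj B. \<forall>h \<in> hom B T (Dom B f). \<forall>k \<in> hom B T (Dom B g).
        f \<cdot>\<^bsub>B\<^esub> h = g \<cdot>\<^bsub>B\<^esub> k \<longrightarrow>
        (\<exists>!u. u \<in> hom B T (Dom B p) \<and> p \<cdot>\<^bsub>B\<^esub> u = h \<and> q \<cdot>\<^bsub>B\<^esub> u = k))"

text \<open>
  The mediating arrow \<open>\<langle>h, k\<rangle>\<close> into a pullback with projections \<open>p\<close>, \<open>q\<close>.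
\<close>

definition mediate :: "('o, 'm, 'z) category_scheme \<Rightarrow> 'm \<Rightarrow> 'm \<Rightarrow> 'm \<Rightarrow> 'm \<Rightarrow> 'm" where
  "mediate B p q h k =
     (THE u. u \<in> hom B (Dom B h) (Dom B p) \<and> p \<cdot>\<^bsub>B\<^esub> u = h \<and> q \<cdot>\<^bsub>B\<^esub> u = k)"

text \<open>
  Chosen finite limits: a terminal object and the two projections of a pullback of every
  cospan; the chosen pullback object is the common domain of the projections.
\<close>

record ('o, 'm) fl_category = "('o, 'm) category" +
  One :: 'o
  Pb1 :: "'m \<Rightarrow> 'm \<Rightarrow> 'm"
  Pb2 :: "'m \<Rightarrow> 'm \<Rightarrow> 'm"

definition is_fl_category :: "('o, 'm, 'z) fl_category_scheme \<Rightarrow> bool" where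
  "is_fl_category B \<longleftrightarrow> is_category B \<and> is_terminal B (One B) \<and>
     (\<forall>f \<in> Arr B. \<forall>g \<in> Arr B. Cod B f = Cod B g \<longrightarrow>
        is_pullback B f g (Pb1 B f g) (Pb2 B f g))"

definition bang :: "('o, 'm, 'z) fl_category_scheme \<Rightarrow> 'o \<Rightarrow> 'm" where
  "bang B X = (THE f. f \<in> hom B X (One B))"

text \<open>Binary products are the chosen pullbacks over the chosen terminal object.\<close>

definition prod1 :: "('o, 'm, 'z) fl_category_scheme \<Rightarrow> 'o \<Rightarrow> 'o \<Rightarrow> 'm" where
  "prod1 B X Y = Pb1 B (bang B X) (bang B Y)"

definition prod2 :: "('o, 'm, 'z) fl_category_scheme \<Rightarrow> 'o \<Rightarrow> 'o \<Rightarrow> 'm" where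
  "prod2 B X Y = Pb2 B (bang B X) (bang B Y)"

definition pair :: "('o, 'm, 'z) fl_category_scheme \<Rightarrow> 'm \<Rightarrow> 'm \<Rightarrow> 'm" where
  "pair B h k = mediate B (prod1 B (Cod B h) (Cod B k)) (prod2 B (Cod B h) (Cod B k)) h k"

record ('o, 'm, 'p, 'n) functr =
  FO :: "'o \<Rightarrow> 'p"
  FA :: "'m \<Rightarrow> 'n"

definition is_functor ::
  "('o, 'm, 'y) category_scheme \<Rightarrow> ('p, 'n, 'z) category_scheme \<Rightarrow> ('o, 'm, 'p, 'n) functr \<Rightarrow> bool"
  where
  "is_functor B D G \<longleftrightarrow>
     (\<forall>X \<in> Obj B. FO G X \<in> Obj D) \<and>
     (\<forall>f \<in> Arr B. FA G f \<in> hom D (FO G (Dom B f)) (FO G (Cod B f))) \<and>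
     (\<forall>X \<in> Obj B. FA G (Idn B X) = Idn D (FO G X)) \<and>
     (\<forall>f \<in> Arr B. \<forall>g \<in> Arr B. Cod B f = Dom B g \<longrightarrow>
        FA G (g \<cdot>\<^bsub>B\<^esub> f) = FA G g \<cdot>\<^bsub>D\<^esub> FA G f)"

text \<open>Strict preservation of the mediating arrows follows from their uniqueness.\<close>

definition strictly_preserves_limits ::
  "('o, 'm, 'y) fl_category_scheme \<Rightarrow> ('p, 'n, 'z) fl_category_scheme \<Rightarrow>
   ('o, 'm, 'p, 'n) functr \<Rightarrow> bool" where
  "strictly_preserves_limits B D G \<longleftrightarrow>
     FO G (One B) = One D \<and>
     (\<forall>f \<in> Arr B. \<forall>g \<in> Arr B. Cod B f = Cod B g \<longrightarrow>
        FA G (Pb1 B f g) = Pb1 D (FA G f) (FA G g) \<and>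
        FA G (Pb2 B f g) = Pb2 D (FA G f) (FA G g))"

definition functor_comp ::
  "('p, 'n, 'q, 'l) functr \<Rightarrow> ('o, 'm, 'p, 'n) functr \<Rightarrow> ('o, 'm, 'q, 'l) functr" where
  "functor_comp K G = \<lparr>FO = (\<lambda>X. FO K (FO G X)), FA = (\<lambda>f. FA K (FA G f))\<rparr>"

definition functor_eq ::
  "('o, 'm, 'z) category_scheme \<Rightarrow> ('o, 'm, 'p, 'n) functr \<Rightarrow> ('o, 'm, 'p, 'n) functr \<Rightarrow> bool"
  where
  "functor_eq B G K \<longleftrightarrow> (\<forall>X \<in> Obj B. FO G X = FO K X) \<and> (\<forall>f \<in> Arr B. FA G f = FA K f)"


section \<open>Internal categories\<close>

text \<open>
  Besides the objects of objects and of morphisms, the record carries the object of composable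
  pairs through its projections \<open>cp1\<close> (first arrow) and \<open>cp2\<close> (second arrow). It may be any
  pullback of \<open>icod\<close> and \<open>idom\<close>, not only the chosen one: in this way applying a finite-limit
  preserving functor to all the data again gives data of the same shape, with no transport
  along comparison isomorphisms. Internal composition \<open>icomp\<close> is in diagrammatic order.
\<close>

record ('o, 'm) icat =
  C0 :: 'o
  C1 :: 'o
  idom :: 'm
  icod :: 'm
  iid :: 'm
  cp1 :: 'm
  cp2 :: 'm
  icomp :: 'm

text \<open>Internal composite \<open>x ; y\<close> of generalized elements \<open>x, y : T \<rightarrow> C1\<close>.\<close>

definition icmp :: "('o, 'm, 'y) category_scheme \<Rightarrow> ('o, 'm, 'z) icat_scheme \<Rightarrow> 'm \<Rightarrow> 'm \<Rightarrow> 'm"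
  where
  "icmp B C x y = icomp C \<cdot>\<^bsub>B\<^esub> mediate B (cp1 C) (cp2 C) x y"

text \<open>
  For associativity, the object of composable triples is the chosen pullback of \<open>cp2\<close> and \<open>cp1\<close>,
  whose elements are pairs \<open>((f, g), (g, h))\<close>.
\<close>

definition is_icat :: "('o, 'm, 'y) fl_category_scheme \<Rightarrow> ('o, 'm, 'z) icat_scheme \<Rightarrow> bool" where
  "is_icat B C \<longleftrightarrow>
     C0 C \<in> Obj B \<and> C1 C \<in> Obj B \<and>
     idom C \<in> hom B (C1 C) (C0 C) \<and> icod C \<in> hom B (C1 C) (C0 C) \<and>
     iid C \<in> hom B (C0 C) (C1 C) \<and>
     is_pullback B (icod C) (idom C) (cp1 C) (cp2 C) \<and>
     icomp C \<in> hom B (Dom B (cp1 C)) (C1 C) \<and>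
     idom C \<cdot>\<^bsub>B\<^esub> iid C = Idn B (C0 C) \<and>
     icod C \<cdot>\<^bsub>B\<^esub> iid C = Idn B (C0 C) \<and>
     idom C \<cdot>\<^bsub>B\<^esub> icomp C = idom C \<cdot>\<^bsub>B\<^esub> cp1 C \<and>
     icod C \<cdot>\<^bsub>B\<^esub> icomp C = icod C \<cdot>\<^bsub>B\<^esub> cp2 C \<and>
     icmp B C (iid C \<cdot>\<^bsub>B\<^esub> idom C) (Idn B (C1 C)) = Idn B (C1 C) \<and>
     icmp B C (Idn B (C1 C)) (iid C \<cdot>\<^bsub>B\<^esub> icod C) = Idn B (C1 C) \<and>
     (let fg = Pb1 B (cp2 C) (cp1 C); gh = Pb2 B (cp2 C) (cp1 C) in
        icmp B C (icomp C \<cdot>\<^bsub>B\<^esub> fg) (cp2 C \<cdot>\<^bsub>B\<^esub> gh) =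
        icmp B C (cp1 C \<cdot>\<^bsub>B\<^esub> fg) (icomp C \<cdot>\<^bsub>B\<^esub> gh))"

text \<open>
  Internal chosen finite limits: the terminal object \<open>iter : One \<rightarrow> C0\<close> with the unique arrow
  \<open>ibang : C0 \<rightarrow> C1\<close> into it; the object of cospans with its projections \<open>cs1\<close>, \<open>cs2\<close> (any
  pullback of \<open>icod\<close> with itself); the two legs \<open>ipb1\<close>, \<open>ipb2\<close> of the chosen pullback of the
  generic cospan; the object of commutative squares with its projections \<open>sq1\<close>, \<open>sq2\<close> (any
  pullback of \<open>icomp\<close> with itself, with elements \<open>((h, f), (k, g))\<close> such that \<open>h ; f = k ; g\<close>);
  and the mediating arrow \<open>imed\<close> of the generic commutative square, from the cone \<open>(h, k)\<close> to
  the chosen pullback of the cospan \<open>(f, g)\<close>.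
\<close>

record ('o, 'm) fl_icat = "('o, 'm) icat" +
  iter :: 'm
  ibang :: 'm
  cs1 :: 'm
  cs2 :: 'm
  ipb1 :: 'm
  ipb2 :: 'm
  sq1 :: 'm
  sq2 :: 'm
  imed :: 'm

text \<open>
  The uniqueness equation of the terminal object says that an arrow \<open>v\<close> with codomain \<open>iter\<close>
  is \<open>ibang\<close> of its domain; the generic such \<open>v\<close> lives on the chosen pullback of \<open>icod\<close>
  and \<open>iter\<close>.
\<close>

definition is_iterminal :: "('o, 'm, 'y) fl_category_scheme \<Rightarrow> ('o, 'm, 'z) fl_icat_scheme \<Rightarrow> bool"
  where
  "is_iterminal B C \<longleftrightarrow>
     iter C \<in> hom B (One B) (C0 C) \<and>
     ibang C \<in> hom B (C0 C) (C1 C) \<and>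
     idom C \<cdot>\<^bsub>B\<^esub> ibang C = Idn B (C0 C) \<and>
     icod C \<cdot>\<^bsub>B\<^esub> ibang C = iter C \<cdot>\<^bsub>B\<^esub> bang B (C0 C) \<and>
     (let v = Pb1 B (icod C) (iter C) in ibang C \<cdot>\<^bsub>B\<^esub> (idom C \<cdot>\<^bsub>B\<^esub> v) = v)"

text \<open>
  The uniqueness equation of the pullback says that an arrow \<open>v\<close> into the pullback of a cospan
  \<open>s\<close> is the mediating arrow of its own composites with the legs; the generic pair \<open>(v, s)\<close>
  lives on the chosen pullback of \<open>icod\<close> and \<open>idom \<cdot> ipb1\<close>.
\<close>

definition is_ipullback :: "('o, 'm, 'y) fl_category_scheme \<Rightarrow> ('o, 'm, 'z) fl_icat_scheme \<Rightarrow> bool"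
  where
  "is_ipullback B C \<longleftrightarrow>
     is_pullback B (icod C) (icod C) (cs1 C) (cs2 C) \<and>
     ipb1 C \<in> hom B (Dom B (cs1 C)) (C1 C) \<and>
     ipb2 C \<in> hom B (Dom B (cs1 C)) (C1 C) \<and>
     idom C \<cdot>\<^bsub>B\<^esub> ipb1 C = idom C \<cdot>\<^bsub>B\<^esub> ipb2 C \<and>
     icod C \<cdot>\<^bsub>B\<^esub> ipb1 C = idom C \<cdot>\<^bsub>B\<^esub> cs1 C \<and>
     icod C \<cdot>\<^bsub>B\<^esub> ipb2 C = idom C \<cdot>\<^bsub>B\<^esub> cs2 C \<and>
     icmp B C (ipb1 C) (cs1 C) = icmp B C (ipb2 C) (cs2 C) \<and>
     is_pullback B (icomp C) (icomp C) (sq1 C) (sq2 C) \<and>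
     imed C \<in> hom B (Dom B (sq1 C)) (C1 C) \<and>
     (let h = cp1 C \<cdot>\<^bsub>B\<^esub> sq1 C; f = cp2 C \<cdot>\<^bsub>B\<^esub> sq1 C;
          k = cp1 C \<cdot>\<^bsub>B\<^esub> sq2 C; g = cp2 C \<cdot>\<^bsub>B\<^esub> sq2 C;
          s = mediate B (cs1 C) (cs2 C) f g
      in idom C \<cdot>\<^bsub>B\<^esub> imed C = idom C \<cdot>\<^bsub>B\<^esub> h \<and>
         icod C \<cdot>\<^bsub>B\<^esub> imed C = idom C \<cdot>\<^bsub>B\<^esub> (ipb1 C \<cdot>\<^bsub>B\<^esub> s) \<and>
         icmp B C (imed C) (ipb1 C \<cdot>\<^bsub>B\<^esub> s) = h \<and>
         icmp B C (imed C) (ipb2 C \<cdot>\<^bsub>B\<^esub> s) = k) \<and>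
     (let v = Pb1 B (icod C) (idom C \<cdot>\<^bsub>B\<^esub> ipb1 C);
          s = Pb2 B (icod C) (idom C \<cdot>\<^bsub>B\<^esub> ipb1 C);
          hf = mediate B (cp1 C) (cp2 C) (icmp B C v (ipb1 C \<cdot>\<^bsub>B\<^esub> s)) (cs1 C \<cdot>\<^bsub>B\<^esub> s);
          kg = mediate B (cp1 C) (cp2 C) (icmp B C v (ipb2 C \<cdot>\<^bsub>B\<^esub> s)) (cs2 C \<cdot>\<^bsub>B\<^esub> s)
      in imed C \<cdot>\<^bsub>B\<^esub> mediate B (sq1 C) (sq2 C) hf kg = v)"

definition is_fl_icat :: "('o, 'm, 'y) fl_category_scheme \<Rightarrow> ('o, 'm, 'z) fl_icat_scheme \<Rightarrow> bool"
  where
  "is_fl_icat B C \<longleftrightarrow> is_icat B C \<and> is_iterminal B C \<and> is_ipullback B C"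

record 'm ifunctor =
  H0 :: 'm
  H1 :: 'm

definition is_ifunctor ::
  "('o, 'm, 'x) category_scheme \<Rightarrow> ('o, 'm, 'y) icat_scheme \<Rightarrow> ('o, 'm, 'z) icat_scheme \<Rightarrow>
   'm ifunctor \<Rightarrow> bool" where
  "is_ifunctor B C D H \<longleftrightarrow>
     H0 H \<in> hom B (C0 C) (C0 D) \<and> H1 H \<in> hom B (C1 C) (C1 D) \<and>
     idom D \<cdot>\<^bsub>B\<^esub> H1 H = H0 H \<cdot>\<^bsub>B\<^esub> idom C \<and>
     icod D \<cdot>\<^bsub>B\<^esub> H1 H = H0 H \<cdot>\<^bsub>B\<^esub> icod C \<and>
     H1 H \<cdot>\<^bsub>B\<^esub> iid C = iid D \<cdot>\<^bsub>B\<^esub> H0 H \<and>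
     H1 H \<cdot>\<^bsub>B\<^esub> icomp C = icmp B D (H1 H \<cdot>\<^bsub>B\<^esub> cp1 C) (H1 H \<cdot>\<^bsub>B\<^esub> cp2 C)"

text \<open>
  Compatibility with \<open>ibang\<close> and \<open>imed\<close> follows from the uniqueness equations of \<open>D\<close>.
\<close>

definition istrictly_preserves_limits ::
  "('o, 'm, 'x) category_scheme \<Rightarrow> ('o, 'm, 'y) fl_icat_scheme \<Rightarrow> ('o, 'm, 'z) fl_icat_scheme \<Rightarrow>
   'm ifunctor \<Rightarrow> bool" where
  "istrictly_preserves_limits B C D H \<longleftrightarrow>
     H0 H \<cdot>\<^bsub>B\<^esub> iter C = iter D \<and>
     (let s = mediate B (cs1 D) (cs2 D) (H1 H \<cdot>\<^bsub>B\<^esub> cs1 C) (H1 H \<cdot>\<^bsub>B\<^esub> cs2 C)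
      in H1 H \<cdot>\<^bsub>B\<^esub> ipb1 C = ipb1 D \<cdot>\<^bsub>B\<^esub> s \<and> H1 H \<cdot>\<^bsub>B\<^esub> ipb2 C = ipb2 D \<cdot>\<^bsub>B\<^esub> s)"

definition ifunctor_comp ::
  "('o, 'm, 'z) category_scheme \<Rightarrow> 'm ifunctor \<Rightarrow> 'm ifunctor \<Rightarrow> 'm ifunctor" where
  "ifunctor_comp B K H = \<lparr>H0 = H0 K \<cdot>\<^bsub>B\<^esub> H0 H, H1 = H1 K \<cdot>\<^bsub>B\<^esub> H1 H\<rparr>"


section \<open>Hom-objects, underlying category and global sections\<close>

definition hom_leg1 ::
  "('o, 'm, 'y) fl_category_scheme \<Rightarrow> ('o, 'm, 'z) icat_scheme \<Rightarrow> 'm \<Rightarrow> 'm \<Rightarrow> 'm" where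
  "hom_leg1 B C X Y = Pb1 B (pair B (idom C) (icod C)) (pair B X Y)"

definition hom_leg2 ::
  "('o, 'm, 'y) fl_category_scheme \<Rightarrow> ('o, 'm, 'z) icat_scheme \<Rightarrow> 'm \<Rightarrow> 'm \<Rightarrow> 'm" where
  "hom_leg2 B C X Y = Pb2 B (pair B (idom C) (icod C)) (pair B X Y)"

definition hom_obj ::
  "('o, 'm, 'y) fl_category_scheme \<Rightarrow> ('o, 'm, 'z) icat_scheme \<Rightarrow> 'm \<Rightarrow> 'm \<Rightarrow> 'o" where
  "hom_obj B C X Y = Dom B (hom_leg1 B C X Y)"

text \<open>
  The factorization through \<open>\<C>(X, Y)\<close> of a generalized element \<open>x : T \<rightarrow> C1\<close> with domain \<open>X\<close> and
  codomain \<open>Y\<close>.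
\<close>

definition hom_lift ::
  "('o, 'm, 'y) fl_category_scheme \<Rightarrow> ('o, 'm, 'z) icat_scheme \<Rightarrow> 'm \<Rightarrow> 'm \<Rightarrow> 'm \<Rightarrow> 'm" where
  "hom_lift B C X Y x =
     mediate B (hom_leg1 B C X Y) (hom_leg2 B C X Y) x (bang B (Dom B x))"

text \<open>Composition \<open>\<C>(X, Y) \<times> \<C>(Y, Z) \<rightarrow> \<C>(X, Z)\<close>.\<close>

definition hom_comp ::
  "('o, 'm, 'y) fl_category_scheme \<Rightarrow> ('o, 'm, 'z) icat_scheme \<Rightarrow> 'm \<Rightarrow> 'm \<Rightarrow> 'm \<Rightarrow> 'm" where
  "hom_comp B C X Y Z = hom_lift B C X Z
     (icmp B C (hom_leg1 B C X Y \<cdot>\<^bsub>B\<^esub> prod1 B (hom_obj B C X Y) (hom_obj B C Y Z))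
               (hom_leg1 B C Y Z \<cdot>\<^bsub>B\<^esub> prod2 B (hom_obj B C X Y) (hom_obj B C Y Z)))"

text \<open>The action \<open>\<C>(X, Y) \<rightarrow> \<D>(\<H>X, \<H>Y)\<close> of an internal functor.\<close>

definition hom_map ::
  "('o, 'm, 'x) fl_category_scheme \<Rightarrow> ('o, 'm, 'y) icat_scheme \<Rightarrow> ('o, 'm, 'z) icat_scheme \<Rightarrow>
   'm ifunctor \<Rightarrow> 'm \<Rightarrow> 'm \<Rightarrow> 'm" where
  "hom_map B C D H X Y =
     hom_lift B D (H0 H \<cdot>\<^bsub>B\<^esub> X) (H0 H \<cdot>\<^bsub>B\<^esub> Y) (H1 H \<cdot>\<^bsub>B\<^esub> hom_leg1 B C X Y)"

text \<open>
  The underlying category, with its induced chosen finite limits. Morphisms \<open>X \<rightarrow> Y\<close>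
  are global elements of \<open>C1\<close> with domain \<open>X\<close> and codomain \<open>Y\<close>.
\<close>

definition Gam :: "('o, 'm, 'y) fl_category_scheme \<Rightarrow> ('o, 'm, 'z) fl_icat_scheme \<Rightarrow>
   ('m, 'm) fl_category" where
  "Gam B C =
     \<lparr>Obj = hom B (One B) (C0 C),
      Arr = hom B (One B) (C1 C),
      Dom = (\<lambda>f. idom C \<cdot>\<^bsub>B\<^esub> f),
      Cod = (\<lambda>f. icod C \<cdot>\<^bsub>B\<^esub> f),
      Idn = (\<lambda>X. iid C \<cdot>\<^bsub>B\<^esub> X),
      Comp = (\<lambda>g f. icmp B C f g),
      One = iter C,
      Pb1 = (\<lambda>f g. ipb1 C \<cdot>\<^bsub>B\<^esub> mediate B (cs1 C) (cs2 C) f g),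
      Pb2 = (\<lambda>f g. ipb2 C \<cdot>\<^bsub>B\<^esub> mediate B (cs1 C) (cs2 C) f g)\<rparr>"

definition Gam_functor :: "('o, 'm, 'z) category_scheme \<Rightarrow> 'm ifunctor \<Rightarrow> ('m, 'm, 'm, 'm) functr"
  where
  "Gam_functor B H = \<lparr>FO = (\<lambda>X. H0 H \<cdot>\<^bsub>B\<^esub> X), FA = (\<lambda>f. H1 H \<cdot>\<^bsub>B\<^esub> f)\<rparr>"

text \<open>
  The global section functor \<open>\<C>(1, -)\<close>; a morphism \<open>f\<close> acts by composition with the global
  element of the hom-object that names it.
\<close>

definition global_sections ::
  "('o, 'm, 'y) fl_category_scheme \<Rightarrow> ('o, 'm, 'z) fl_icat_scheme \<Rightarrow> ('m, 'm, 'o, 'm) functr"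
  where
  "global_sections B C =
     \<lparr>FO = (\<lambda>X. hom_obj B C (iter C) X),
      FA = (\<lambda>f. let X = idom C \<cdot>\<^bsub>B\<^esub> f; Y = icod C \<cdot>\<^bsub>B\<^esub> f; S = hom_obj B C (iter C) X in
         hom_comp B C (iter C) X Y \<cdot>\<^bsub>B\<^esub>
           pair B (Idn B S) (hom_lift B C X Y f \<cdot>\<^bsub>B\<^esub> bang B S))\<rparr>"


section \<open>Applying a finite-limit preserving functor to an internal category\<close>

text \<open>The unique isomorphism \<open>1 \<cong> G 1\<close>.\<close>

definition one_iso ::
  "('o, 'm, 'y) fl_category_scheme \<Rightarrow> ('p, 'n, 'z) fl_category_scheme \<Rightarrow>
   ('o, 'm, 'p, 'n) functr \<Rightarrow> 'n" where
  "one_iso B D G = (THE u. u \<in> hom D (One D) (FO G (One B)))"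

definition apply_icat ::
  "('o, 'm, 'y) fl_category_scheme \<Rightarrow> ('p, 'n, 'z) fl_category_scheme \<Rightarrow>
   ('o, 'm, 'p, 'n) functr \<Rightarrow> ('o, 'm) fl_icat \<Rightarrow> ('p, 'n) fl_icat" where
  "apply_icat B D G C =
     \<lparr>C0 = FO G (C0 C), C1 = FO G (C1 C),
      idom = FA G (idom C), icod = FA G (icod C), iid = FA G (iid C),
      cp1 = FA G (cp1 C), cp2 = FA G (cp2 C), icomp = FA G (icomp C),
      iter = FA G (iter C) \<cdot>\<^bsub>D\<^esub> one_iso B D G, ibang = FA G (ibang C),
      cs1 = FA G (cs1 C), cs2 = FA G (cs2 C),
      ipb1 = FA G (ipb1 C), ipb2 = FA G (ipb2 C),
      sq1 = FA G (sq1 C), sq2 = FA G (sq2 C), imed = FA G (imed C)\<rparr>"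

definition apply_ifunctor :: "('o, 'm, 'p, 'n) functr \<Rightarrow> 'm ifunctor \<Rightarrow> 'n ifunctor" where
  "apply_ifunctor G H = \<lparr>H0 = FA G (H0 H), H1 = FA G (H1 H)\<rparr>"

text \<open>The functor \<open>G\<^sup># : \<Gamma> \<C> \<rightarrow> \<Gamma> (G \<C>)\<close>; its action does not depend on \<open>\<C>\<close>.\<close>

definition sharp ::
  "('o, 'm, 'y) fl_category_scheme \<Rightarrow> ('p, 'n, 'z) fl_category_scheme \<Rightarrow>
   ('o, 'm, 'p, 'n) functr \<Rightarrow> ('m, 'm, 'n, 'n) functr" where
  "sharp B D G =
     \<lparr>FO = (\<lambda>X. FA G X \<cdot>\<^bsub>D\<^esub> one_iso B D G), FA = (\<lambda>f. FA G f \<cdot>\<^bsub>D\<^esub> one_iso B D G)\<rparr>"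

text \<open>The canonical isomorphism \<open>(G \<C>)(G\<^sup># X, G\<^sup># Y) \<cong> G (\<C>(X, Y))\<close>.\<close>

definition hom_iso ::
  "('o, 'm, 'y) fl_category_scheme \<Rightarrow> ('p, 'n, 'z) fl_category_scheme \<Rightarrow>
   ('o, 'm, 'p, 'n) functr \<Rightarrow> ('o, 'm) fl_icat \<Rightarrow> 'm \<Rightarrow> 'm \<Rightarrow> 'n" where
  "hom_iso B D G C X Y =
     (let GC = apply_icat B D G C; X' = FO (sharp B D G) X; Y' = FO (sharp B D G) Y in
      mediate D (FA G (hom_leg1 B C X Y)) (FA G (hom_leg2 B C X Y))
        (hom_leg1 D GC X' Y') (one_iso B D G \<cdot>\<^bsub>D\<^esub> hom_leg2 D GC X' Y'))"


section \<open>Geminal categories\<close>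

definition box ::
  "('o, 'm, 'z) fl_category_scheme \<Rightarrow> ('o, 'm) fl_icat \<Rightarrow> ('o, 'm, 'm, 'm) functr \<Rightarrow>
   ('o, 'm, 'o, 'm) functr" where
  "box B C F = functor_comp (global_sections B C) F"

definition box_icat ::
  "('o, 'm, 'z) fl_category_scheme \<Rightarrow> ('o, 'm) fl_icat \<Rightarrow> ('o, 'm, 'm, 'm) functr \<Rightarrow>
   ('o, 'm) fl_icat" where
  "box_icat B C F = apply_icat B B (box B C F) C"

definition pre_geminal ::
  "('o, 'm, 'z) fl_category_scheme \<Rightarrow> ('o, 'm) fl_icat \<Rightarrow> ('o, 'm, 'm, 'm) functr \<Rightarrow>
   'm ifunctor \<Rightarrow> bool" where
  "pre_geminal B C F H \<longleftrightarrow>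
     is_fl_category B \<and>
     is_fl_icat B C \<and>
     is_functor B (Gam B C) F \<and> strictly_preserves_limits B (Gam B C) F \<and>
     is_ifunctor B C (box_icat B C F) H \<and>
     functor_eq B (functor_comp (Gam_functor B H) F) (functor_comp (sharp B B (box B C F)) F)"

text \<open>
  The map \<open>\<sigma>\<^sub>A : \<box>A = \<C>(1, FA) \<rightarrow> (\<box>\<C>)(\<H>1, \<H>FA) \<cong> \<box>(\<C>(1, FA)) = \<box>\<box>A\<close>, that is, \<open>\<H>\<close> acting on
  \<open>\<C>(1, FA)\<close> and regarded as a morphism into \<open>\<C>(1, F\<box>A)\<close>.
\<close>

definition box_quote ::
  "('o, 'm, 'z) fl_category_scheme \<Rightarrow> ('o, 'm) fl_icat \<Rightarrow> ('o, 'm, 'm, 'm) functr \<Rightarrow>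
   'm ifunctor \<Rightarrow> 'o \<Rightarrow> 'm" where
  "box_quote B C F H A =
     hom_iso B B (box B C F) C (iter C) (FO F A) \<cdot>\<^bsub>B\<^esub>
       hom_map B C (box_icat B C F) H (iter C) (FO F A)"

text \<open>The internal functor \<open>\<H>\<^sup># : \<box>\<C> \<rightarrow> \<box>\<box>\<C>\<close>.\<close>

definition isharp ::
  "('o, 'm, 'z) fl_category_scheme \<Rightarrow> ('o, 'm) fl_icat \<Rightarrow> ('o, 'm, 'm, 'm) functr \<Rightarrow>
   'm ifunctor \<Rightarrow> 'm ifunctor" where
  "isharp B C F H = \<lparr>H0 = box_quote B C F H (C0 C), H1 = box_quote B C F H (C1 C)\<rparr>"

definition geminal ::
  "('o, 'm, 'z) fl_category_scheme \<Rightarrow> ('o, 'm) fl_icat \<Rightarrow> ('o, 'm, 'm, 'm) functr \<Rightarrow>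
   'm ifunctor \<Rightarrow> bool" where
  "geminal B C F H \<longleftrightarrow>
     pre_geminal B C F H \<and>
     istrictly_preserves_limits B C (box_icat B C F) H \<and>
     ifunctor_comp B (apply_ifunctor (box B C F) H) H = ifunctor_comp B (isharp B C F H) H"

end

theory Submission
  imports Defs
begin

text \<open>
  As in the proof of Loeb's theorem, one needs an object \<open>D\<close> of \<open>\<B>\<close> with \<open>D \<cong> \<C>(F D, F A)\<close>; it comes
  from a diagonal construction with the object of morphisms of \<open>\<C>\<close> as the object of codes. An element
  \<open>d\<close> of \<open>D\<close> can be applied to its own code \<open>\<H> d : 1 \<rightarrow> F D\<close>, which gives \<open>s : D \<rightarrow> \<box>A\<close>,
  \<open>s d = d \<circ> \<H> d\<close>. For \<open>k : F \<box>A \<rightarrow> F A\<close> put \<open>d = k \<circ> F s\<close> and \<open>Y k = s d\<close>. Then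
  \<open>Y k = k \<circ> F s \<circ> \<H> d\<close>, and \<open>F s \<circ> \<H> d = \<H> (s d) = \<H> (Y k)\<close> because the two ways of iterating \<open>\<H>\<close>
  agree in a geminal category.
\<close>

section \<open>Categories with chosen finite limits\<close>

text \<open>\<open>D\<close> would occur in its own description, so it cannot be formed directly.
  The self-reference comes from the equation between \<open>H\<close> and \<open>F\<close>: for
  \<open>p\<close> in \<open>B\<close> ending in \<open>C1 C\<close>, the arrow \<open>F p\<close>
  is a global element of \<open>C1 C\<close>, and its code under \<open>H\<close> is
  \<open>F (F p)\<close>. The fibre of \<open>p\<close> over \<open>F p\<close>, formed in
  \<open>B\<close>, is therefore mapped by \<open>F\<close> to the fibre of \<open>F p\<close> over
  its own code. Because \<open>F\<close> preserves chosen limits on the nose, the outcome is an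
  equation of objects of \<C> and not only an isomorphism.

  To avoid transport, \<open>D\<close> is never compared with the chosen hom-object. It is kept as
  one more pullback with a leg \<open>e\<close> into \<open>C1 C\<close>, and quotation on it is a
  map \<open>h\<close> with \<open>\<box>e \<cdot> h = \<H> \<cdot> e\<close>. Every hom-object is
  handled through its leg: legs are mono, \<box> preserves pullbacks and hence monos, so an equation
  between arrows into \<open>\<box>A\<close>, \<open>\<box>\<box>A\<close> or
  \<open>\<box>\<box>D\<close> reduces to one about \<open>H\<close> and internal composition. The
  equation between the two iterations of \<open>H\<close> enters once, for \<open>h\<close>.\<close>

locale fl_cat =
  fixes B :: "('o, 'm, 'z) fl_category_scheme" (structure)
  assumes fl_category: "is_fl_category B"
begin

lemma in_hom [simp]: "f \<in> hom B X Y \<longleftrightarrow> f \<in> Arr B \<and> Dom B f = X \<and> Cod B f = Y"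
  by (auto simp: hom_def)

lemma category: "is_category B"
  using fl_category by (simp add: is_fl_category_def)

lemma dom_cod_obj [simp]:
  assumes "f \<in> Arr B"
  shows "Dom B f \<in> Obj B" "Cod B f \<in> Obj B"
  using category assms by (simp_all add: is_category_def)

lemma idn [simp]:
  assumes "X \<in> Obj B"
  shows "Idn B X \<in> Arr B" "Dom B (Idn B X) = X" "Cod B (Idn B X) = X"
  using category assms by (simp_all add: is_category_def)

lemma comp [simp]:
  assumes "f \<in> Arr B" "g \<in> Arr B" "Cod B f = Dom B g"
  shows "g \<cdot> f \<in> Arr B" "Dom B (g \<cdot> f) = Dom B f" "Cod B (g \<cdot> f) = Cod B g"
  using category assms by (simp_all add: is_category_def)

lemma comp_idn [simp]:
  assumes "f \<in> Arr B"
  shows "Dom B f = X \<Longrightarrow> f \<cdot> Idn B X = f" "Cod B f = X \<Longrightarrow> Idn B X \<cdot> f = f"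
  using category assms by (auto simp add: is_category_def)

lemma comp_assoc [simp]:
  assumes "f \<in> Arr B" "g \<in> Arr B" "h \<in> Arr B" "Cod B f = Dom B g" "Cod B g = Dom B h"
  shows "(h \<cdot> g) \<cdot> f = h \<cdot> (g \<cdot> f)"
  using category assms by (simp add: is_category_def)

text \<open>Composites are normalized to the right, where \<open>g \<cdot> f\<close> is not a
  subterm of \<open>g \<cdot> (f \<cdot> t)\<close>; this rule and \<open>square_extend\<close> make
  an equation usable there.\<close>

lemma comp_extend:
  assumes "g \<cdot> f = k" "f \<in> Arr B" "g \<in> Arr B" "Cod B f = Dom B g" "t \<in> Arr B" "Cod B t = Dom B f"
  shows "g \<cdot> (f \<cdot> t) = k \<cdot> t"
  using assms comp_assoc by metis

lemma square_extend:
  assumes "g \<cdot> f = g' \<cdot> f'" "f \<in> Arr B" "g \<in> Arr B" "Cod B f = Dom B g"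
    "f' \<in> Arr B" "g' \<in> Arr B" "Cod B f' = Dom B g'"
    "t \<in> Arr B" "Cod B t = Dom B f" "Cod B t = Dom B f'"
  shows "g \<cdot> (f \<cdot> t) = g' \<cdot> (f' \<cdot> t)"
  using assms comp_assoc by metis

lemma one_obj [simp]: "One B \<in> Obj B"
  using fl_category by (simp add: is_fl_category_def is_terminal_def)

lemma bang_ex1: "X \<in> Obj B \<Longrightarrow> \<exists>!f. f \<in> hom B X (One B)"
  using fl_category by (simp only: is_fl_category_def is_terminal_def)

lemma bang [simp]:
  assumes "X \<in> Obj B"
  shows "bang B X \<in> Arr B" "Dom B (bang B X) = X" "Cod B (bang B X) = One B"
  using theI' [OF bang_ex1 [OF assms]] unfolding bang_def by simp_all

lemma bang_unique: "f \<in> Arr B \<Longrightarrow> Cod B f = One B \<Longrightarrow> f = bang B (Dom B f)"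
  using bang_ex1 [of "Dom B f"] by (metis bang dom_cod_obj(1) in_hom)

lemma bang_comp [simp]:
  "t \<in> Arr B \<Longrightarrow> Cod B t = X \<Longrightarrow> bang B X \<cdot> t = bang B (Dom B t)"
  using bang_unique [of "bang B X \<cdot> t"] by fastforce

lemma comp_bang [simp]:
  assumes "x \<in> Arr B" "Dom B x = One B"
  shows "x \<cdot> bang B (One B) = x"
  using bang_unique [of "Idn B (One B)"] assms by (metis comp_idn(1) idn one_obj)

section \<open>Pullbacks and their mediating arrows\<close>

lemma chosen_pullback:
  assumes "f \<in> Arr B" "g \<in> Arr B" "Cod B f = Cod B g"
  shows "is_pullback B f g (Pb1 B f g) (Pb2 B f g)"
  using fl_category assms by (simp add: is_fl_category_def)

lemma pullback_arr:
  assumes "is_pullback B f g p q"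
  shows "f \<in> Arr B" "g \<in> Arr B" "Cod B f = Cod B g" "p \<in> Arr B" "q \<in> Arr B"
    "Cod B p = Dom B f" "Cod B q = Dom B g" "Dom B q = Dom B p" "f \<cdot> p = g \<cdot> q"
  using assms by (simp_all add: is_pullback_def)

lemma pullback_ex1:
  assumes "is_pullback B f g p q" "h \<in> Arr B" "k \<in> Arr B" "Dom B h = Dom B k"
    "Cod B h = Dom B f" "Cod B k = Dom B g" "f \<cdot> h = g \<cdot> k"
  shows "\<exists>!u. u \<in> hom B (Dom B h) (Dom B p) \<and> p \<cdot> u = h \<and> q \<cdot> u = k"
proof -
  have "\<forall>T \<in> Obj B. \<forall>h \<in> hom B T (Dom B f). \<forall>k \<in> hom B T (Dom B g).
        f \<cdot> h = g \<cdot> k \<longrightarrow> (\<exists>!u. u \<in> hom B T (Dom B p) \<and> p \<cdot> u = h \<and> q \<cdot> u = k)"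
    using assms(1) unfolding is_pullback_def by blast
  with assms show ?thesis
    by (metis dom_cod_obj(1) in_hom)
qed

lemma mediate:
  assumes "is_pullback B f g p q" "h \<in> Arr B" "k \<in> Arr B" "Dom B h = Dom B k"
    "Cod B h = Dom B f" "Cod B k = Dom B g" "f \<cdot> h = g \<cdot> k"
  shows "mediate B p q h k \<in> Arr B" "Dom B (mediate B p q h k) = Dom B h"
    "Cod B (mediate B p q h k) = Dom B p"
    "p \<cdot> mediate B p q h k = h" "q \<cdot> mediate B p q h k = k"
  using theI' [OF pullback_ex1 [OF assms]] unfolding mediate_def by simp_all

lemma pullback_eqI:
  assumes pb: "is_pullback B f g p q" and u: "u \<in> Arr B" "Cod B u = Dom B p"
    and v: "v \<in> Arr B" "Cod B v = Dom B p"
    and eq: "Dom B u = Dom B v" "p \<cdot> u = p \<cdot> v" "q \<cdot> u = q \<cdot> v"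
  shows "u = v"
proof -
  note a = pullback_arr [OF pb]
  have "f \<cdot> (p \<cdot> u) = g \<cdot> (q \<cdot> u)"
    using a u by - (rule square_extend, auto)
  then have "\<exists>!w. w \<in> hom B (Dom B (p \<cdot> u)) (Dom B p) \<and> p \<cdot> w = p \<cdot> u \<and> q \<cdot> w = q \<cdot> u"
    using a u by (intro pullback_ex1 [OF pb]) auto
  then show ?thesis
    using a u v eq by (smt (verit) comp(2) in_hom)
qed

lemma mediate_eqI:
  assumes "is_pullback B f g p q" "u \<in> Arr B" "Cod B u = Dom B p" "p \<cdot> u = h" "q \<cdot> u = k"
  shows "mediate B p q h k = u"
proof -
  note a = pullback_arr [OF assms(1)]
  have eq: "f \<cdot> (p \<cdot> u) = g \<cdot> (q \<cdot> u)"
    using assms(2,3) a by - (rule square_extend, auto)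
  have "p \<cdot> u \<in> Arr B" "q \<cdot> u \<in> Arr B" "Dom B (p \<cdot> u) = Dom B (q \<cdot> u)"
    "Cod B (p \<cdot> u) = Dom B f" "Cod B (q \<cdot> u) = Dom B g"
    using assms(2,3) a by simp_all
  note m = mediate [OF assms(1) this eq]
  have "mediate B p q (p \<cdot> u) (q \<cdot> u) = u"
    by (rule pullback_eqI [OF assms(1) m(1) m(3) assms(2,3) _ m(4,5)]) (use m(2) assms(2,3) a in simp)
  then show ?thesis
    using assms(4,5) by simp
qed

lemma mediate_comp:
  assumes "is_pullback B f g p q" "h \<in> Arr B" "k \<in> Arr B" "Dom B h = Dom B k"
    "Cod B h = Dom B f" "Cod B k = Dom B g" "f \<cdot> h = g \<cdot> k"
    and "t \<in> Arr B" "Cod B t = Dom B h"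
  shows "mediate B p q h k \<cdot> t = mediate B p q (h \<cdot> t) (k \<cdot> t)"
  using mediate [OF assms(1-7)] pullback_arr [OF assms(1)] assms(8,9)
  by (intro mediate_eqI [OF assms(1), symmetric] comp_extend) auto

text \<open>With \<open>chosen_pullback_iso\<close>, this carries preservation of the chosen
  pullbacks over to the arbitrary pullbacks that occur in the data of an internal category.\<close>

lemma pullback_iso:
  assumes pb: "is_pullback B f g p q"
    and i: "i \<in> Arr B" "Cod B i = Dom B p"
    and j: "j \<in> Arr B" "Dom B j = Dom B p" "Cod B j = Dom B i"
    and inv: "i \<cdot> j = Idn B (Dom B p)" "j \<cdot> i = Idn B (Dom B i)"
  shows "is_pullback B f g (p \<cdot> i) (q \<cdot> i)"
proof -
  note a = pullback_arr [OF pb]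
  have ex1: "\<exists>!u. u \<in> hom B T (Dom B (p \<cdot> i)) \<and> (p \<cdot> i) \<cdot> u = h \<and> (q \<cdot> i) \<cdot> u = k"
    if "T \<in> Obj B" and h: "h \<in> hom B T (Dom B f)" and k: "k \<in> hom B T (Dom B g)"
      and eq: "f \<cdot> h = g \<cdot> k" for T h k
  proof -
    let ?m = "mediate B p q h k"
    have hk: "h \<in> Arr B" "k \<in> Arr B" "Dom B h = Dom B k" "Cod B h = Dom B f" "Cod B k = Dom B g"
      using h k by auto
    note m = mediate [OF pb hk eq]
    show ?thesis
    proof (intro ex1I [of _ "j \<cdot> ?m"] conjI)
      have *: "i \<cdot> (j \<cdot> ?m) = ?m"
        using comp_extend [OF inv(1), of ?m] m a i j by simp
      show "j \<cdot> ?m \<in> hom B T (Dom B (p \<cdot> i))"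
        using m a i j h by simp
      show "(p \<cdot> i) \<cdot> (j \<cdot> ?m) = h" "(q \<cdot> i) \<cdot> (j \<cdot> ?m) = k"
        using * m a i j by simp_all
    next
      fix u
      assume u: "u \<in> hom B T (Dom B (p \<cdot> i)) \<and> (p \<cdot> i) \<cdot> u = h \<and> (q \<cdot> i) \<cdot> u = k"
      then have "?m = i \<cdot> u"
        using a i by (intro mediate_eqI [OF pb]) auto
      then show "u = j \<cdot> ?m"
        using comp_extend [OF inv(2), of u] u a i j by simp
    qed
  qed
  have "f \<cdot> (p \<cdot> i) = g \<cdot> (q \<cdot> i)"
    using a i by - (rule square_extend, auto)
  then show ?thesis
    using a i unfolding is_pullback_def by (intro conjI ballI impI ex1) auto
qed

lemma chosen_pullback_iso:
  assumes pb: "is_pullback B f g p q"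
  obtains i j where "i \<in> Arr B" "Dom B i = Dom B p" "Cod B i = Dom B (Pb1 B f g)"
    "j \<in> Arr B" "Dom B j = Dom B (Pb1 B f g)" "Cod B j = Dom B p"
    "i \<cdot> j = Idn B (Dom B (Pb1 B f g))" "j \<cdot> i = Idn B (Dom B p)"
    "Pb1 B f g \<cdot> i = p" "Pb2 B f g \<cdot> i = q"
proof -
  note a = pullback_arr [OF pb]
  note c = chosen_pullback [OF a(1-3)]
  note b = pullback_arr [OF c]
  let ?i = "mediate B (Pb1 B f g) (Pb2 B f g) p q"
  let ?j = "mediate B p q (Pb1 B f g) (Pb2 B f g)"
  have i: "?i \<in> Arr B" "Dom B ?i = Dom B p" "Cod B ?i = Dom B (Pb1 B f g)"
      "Pb1 B f g \<cdot> ?i = p" "Pb2 B f g \<cdot> ?i = q"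
    using mediate [OF c, of p q] a by auto
  have j: "?j \<in> Arr B" "Dom B ?j = Dom B (Pb1 B f g)" "Cod B ?j = Dom B p"
      "p \<cdot> ?j = Pb1 B f g" "q \<cdot> ?j = Pb2 B f g"
    using mediate [OF pb, of "Pb1 B f g" "Pb2 B f g"] b by auto
  have 1: "?i \<cdot> ?j = Idn B (Dom B (Pb1 B f g))"
  proof (rule pullback_eqI [OF c])
    show "Pb1 B f g \<cdot> (?i \<cdot> ?j) = Pb1 B f g \<cdot> Idn B (Dom B (Pb1 B f g))"
      using comp_extend [OF i(4), of ?j] i j a b by simp
    show "Pb2 B f g \<cdot> (?i \<cdot> ?j) = Pb2 B f g \<cdot> Idn B (Dom B (Pb1 B f g))"
      using comp_extend [OF i(5), of ?j] i j a b by simp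
  qed (use i j b in auto)
  have 2: "?j \<cdot> ?i = Idn B (Dom B p)"
  proof (rule pullback_eqI [OF pb])
    show "p \<cdot> (?j \<cdot> ?i) = p \<cdot> Idn B (Dom B p)"
      using comp_extend [OF j(4), of ?i] i j a b by simp
    show "q \<cdot> (?j \<cdot> ?i) = q \<cdot> Idn B (Dom B p)"
      using comp_extend [OF j(5), of ?i] i j a b by simp
  qed (use i j a in auto)
  show ?thesis
    using that i j 1 2 by blast
qed

section \<open>Monomorphisms and pasting\<close>

definition mono_arr :: "'m \<Rightarrow> bool" where
  "mono_arr m \<longleftrightarrow> m \<in> Arr B \<and>
     (\<forall>T u v. u \<in> hom B T (Dom B m) \<longrightarrow> v \<in> hom B T (Dom B m) \<longrightarrow> m \<cdot> u = m \<cdot> v \<longrightarrow> u = v)"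

lemma mono_arrD:
  assumes "mono_arr m" "u \<in> hom B T (Dom B m)" "v \<in> hom B T (Dom B m)" "m \<cdot> u = m \<cdot> v"
  shows "u = v"
  using assms unfolding mono_arr_def by blast

text \<open>Pulling back along \<open>g\<close> and then along \<open>m\<close> is pulling back
  along the composite. In the diagonal construction it specializes a family of hom-objects to its
  fibre at one point.\<close>

lemma pullback_paste:
  assumes fg: "is_pullback B f g x y" and ym: "is_pullback B y m c b"
  shows "is_pullback B f (g \<cdot> m) (x \<cdot> c) b"
proof -
  note a = pullback_arr [OF fg] and a' = pullback_arr [OF ym]
  have "\<exists>!u. u \<in> hom B T (Dom B (x \<cdot> c)) \<and> (x \<cdot> c) \<cdot> u = h \<and> b \<cdot> u = k"
    if "T \<in> Obj B" and h: "h \<in> hom B T (Dom B f)" and k: "k \<in> hom B T (Dom B (g \<cdot> m))"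
      and eq: "f \<cdot> h = (g \<cdot> m) \<cdot> k" for T h k
  proof -
    let ?u = "mediate B x y h (m \<cdot> k)"
    have u: "?u \<in> Arr B" "Dom B ?u = T" "Cod B ?u = Dom B x" "x \<cdot> ?u = h" "y \<cdot> ?u = m \<cdot> k"
      using mediate [OF fg, of h "m \<cdot> k"] h k eq a a' by auto
    let ?v = "mediate B c b ?u k"
    have v: "?v \<in> Arr B" "Dom B ?v = T" "Cod B ?v = Dom B c" "c \<cdot> ?v = ?u" "b \<cdot> ?v = k"
      using mediate [OF ym, of ?u k] u k a a' by auto
    show ?thesis
    proof (intro ex1I [of _ ?v] conjI)
      show "?v \<in> hom B T (Dom B (x \<cdot> c))" "(x \<cdot> c) \<cdot> ?v = h" "b \<cdot> ?v = k"
        using u v a a' by simp_all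
    next
      fix w
      assume w: "w \<in> hom B T (Dom B (x \<cdot> c)) \<and> (x \<cdot> c) \<cdot> w = h \<and> b \<cdot> w = k"
      have w': "w \<in> Arr B" "Cod B w = Dom B c" "x \<cdot> (c \<cdot> w) = h" "b \<cdot> w = k"
        using w a a' by auto
      have "y \<cdot> (c \<cdot> w) = m \<cdot> k"
        using square_extend [OF a'(9), of w] w' a a' by simp
      then have "?u = c \<cdot> w"
        using w' a a' by (intro mediate_eqI [OF fg]) auto
      then show "w = ?v"
        using w' by (intro mediate_eqI [OF ym, symmetric]) auto
    qed
  qed
  note ex1 = this
  have "f \<cdot> (x \<cdot> c) = g \<cdot> (y \<cdot> c)"
    using a a' by (intro square_extend) auto
  then have "f \<cdot> (x \<cdot> c) = (g \<cdot> m) \<cdot> b"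
    using a a' by simp
  then show ?thesis
    using a a' unfolding is_pullback_def by (intro conjI ballI impI ex1) simp_all
qed

text \<open>A mono tests equality of arrows into its domain, so \<open>y\<close>, \<open>m\<close>
  and their composites with \<open>n\<close> have the same commuting cones.\<close>

lemma pullback_cancel_mono:
  assumes n: "mono_arr n" and y: "y \<in> hom B P (Dom B n)" and m: "m \<in> hom B U (Dom B n)"
    and pb: "is_pullback B (n \<cdot> y) (n \<cdot> m) c b"
  shows "is_pullback B y m c b"
proof -
  have n': "n \<in> Arr B"
    using n by (simp add: mono_arr_def)
  note a = pullback_arr [OF pb]
  have cb: "c \<in> hom B (Dom B c) P" "b \<in> hom B (Dom B c) U"
    using a n' y m by auto
  have "\<exists>!u. u \<in> hom B T (Dom B c) \<and> c \<cdot> u = h \<and> b \<cdot> u = k"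
    if "T \<in> Obj B" and h: "h \<in> hom B T (Dom B y)" and k: "k \<in> hom B T (Dom B m)"
      and eq: "y \<cdot> h = m \<cdot> k" for T h k
    using pullback_ex1 [OF pb, of h k] h k eq n' y m by simp
  note ex1 = this
  have "n \<cdot> (y \<cdot> c) = n \<cdot> (m \<cdot> b)"
    using a(9) cb y m n' by simp
  then have "y \<cdot> c = m \<cdot> b"
    using cb y m by - (rule mono_arrD [OF n, of _ "Dom B c"], simp_all)
  then show ?thesis
    using cb y m unfolding is_pullback_def by (intro conjI ballI impI ex1) simp_all
qed

section \<open>Binary products\<close>

lemma prod_pullback:
  assumes "X \<in> Obj B" "Y \<in> Obj B"
  shows "is_pullback B (bang B X) (bang B Y) (prod1 B X Y) (prod2 B X Y)"
  unfolding prod1_def prod2_def using assms by (intro chosen_pullback) auto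

lemma prod [simp]:
  assumes "X \<in> Obj B" "Y \<in> Obj B"
  shows "prod1 B X Y \<in> Arr B" "Cod B (prod1 B X Y) = X"
    "prod2 B X Y \<in> Arr B" "Dom B (prod2 B X Y) = Dom B (prod1 B X Y)" "Cod B (prod2 B X Y) = Y"
  using pullback_arr [OF prod_pullback [OF assms]] assms by auto

lemma pair [simp]:
  assumes "h \<in> Arr B" "k \<in> Arr B" "Dom B h = Dom B k"
  shows "pair B h k \<in> Arr B" "Dom B (pair B h k) = Dom B k"
    "Cod B (pair B h k) = Dom B (prod1 B (Cod B h) (Cod B k))"
    "Cod B h = X \<Longrightarrow> Cod B k = Y \<Longrightarrow> prod1 B X Y \<cdot> pair B h k = h"
    "Cod B h = X \<Longrightarrow> Cod B k = Y \<Longrightarrow> prod2 B X Y \<cdot> pair B h k = k"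
  using mediate [OF prod_pullback, of "Cod B h" "Cod B k" h k] assms
  unfolding pair_def by auto

lemma pair_comp:
  assumes "h \<in> Arr B" "k \<in> Arr B" "Dom B h = Dom B k" "t \<in> Arr B" "Cod B t = Dom B h"
  shows "pair B h k \<cdot> t = pair B (h \<cdot> t) (k \<cdot> t)"
  using mediate_comp [OF prod_pullback, of "Cod B h" "Cod B k" h k t] assms
  unfolding pair_def by auto

end


section \<open>Generalized elements of internal categories\<close>

text \<open>
  No axiom of an internal category is required, so that \<open>\<box>\<C>\<close>, of which nothing more is needed, is
  an instance.
\<close>

locale comp_graph = fl_cat B for B :: "('o, 'm, 'z) fl_category_scheme" (structure) +
  fixes C :: "('o, 'm, 'y) icat_scheme"
  assumes C_obj [simp]: "C0 C \<in> Obj B" "C1 C \<in> Obj B"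
    and ends [simp]: "idom C \<in> Arr B" "Dom B (idom C) = C1 C" "Cod B (idom C) = C0 C"
      "icod C \<in> Arr B" "Dom B (icod C) = C1 C" "Cod B (icod C) = C0 C"
    and cp: "is_pullback B (icod C) (idom C) (cp1 C) (cp2 C)"
    and icomp [simp]: "icomp C \<in> Arr B" "Dom B (icomp C) = Dom B (cp1 C)" "Cod B (icomp C) = C1 C"

text \<open>An internal arrow from \<open>X\<close> to \<open>Y\<close> at stage \<open>T\<close>.
  The ends are determined by \<open>x\<close>; as arguments they let composability be settled by
  unification.\<close>

definition iarrow :: "('o, 'm, 'y) category_scheme \<Rightarrow> ('o, 'm, 'z) icat_scheme \<Rightarrow>
    'o \<Rightarrow> 'm \<Rightarrow> 'm \<Rightarrow> 'm \<Rightarrow> bool" where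
  "iarrow B C T X Y x \<longleftrightarrow>
     x \<in> hom B T (C1 C) \<and> idom C \<cdot>\<^bsub>B\<^esub> x = X \<and> icod C \<cdot>\<^bsub>B\<^esub> x = Y"

context comp_graph
begin

lemma cp_arr [simp]: "cp1 C \<in> Arr B" "Cod B (cp1 C) = C1 C"
    "cp2 C \<in> Arr B" "Dom B (cp2 C) = Dom B (cp1 C)" "Cod B (cp2 C) = C1 C"
  using pullback_arr [OF cp] by simp_all

lemma iarrowD:
  assumes "iarrow B C T X Y x"
  shows "x \<in> Arr B" "Dom B x = T" "Cod B x = C1 C" "idom C \<cdot> x = X" "icod C \<cdot> x = Y"
    "T \<in> Obj B" "X \<in> Arr B" "Dom B X = T" "Cod B X = C0 C" "Y \<in> Arr B" "Dom B Y = T" "Cod B Y = C0 C"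
  using assms by (auto simp: iarrow_def)

lemma iarrow_comp:
  assumes "iarrow B C T X Y x" "t \<in> Arr B" "Cod B t = T"
  shows "iarrow B C (Dom B t) (X \<cdot> t) (Y \<cdot> t) (x \<cdot> t)"
  using assms by (auto simp: iarrow_def)

lemma iarrow_mediate:
  assumes "iarrow B C T X Y x" "iarrow B C T Y Z y"
  shows "mediate B (cp1 C) (cp2 C) x y \<in> Arr B" "Dom B (mediate B (cp1 C) (cp2 C) x y) = T"
    "Cod B (mediate B (cp1 C) (cp2 C) x y) = Dom B (cp1 C)"
    "cp1 C \<cdot> mediate B (cp1 C) (cp2 C) x y = x" "cp2 C \<cdot> mediate B (cp1 C) (cp2 C) x y = y"
  using mediate [OF cp, of x y] iarrowD [OF assms(1)] iarrowD [OF assms(2)] by auto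

lemma icmp_arr:
  assumes "iarrow B C T X Y x" "iarrow B C T Y Z y"
  shows "icmp B C x y \<in> Arr B" "Dom B (icmp B C x y) = T" "Cod B (icmp B C x y) = C1 C"
  using iarrow_mediate [OF assms] by (simp_all add: icmp_def)

lemma icmp_comp:
  assumes "iarrow B C T X Y x" "iarrow B C T Y Z y" "t \<in> Arr B" "Cod B t = T"
  shows "icmp B C x y \<cdot> t = icmp B C (x \<cdot> t) (y \<cdot> t)"
  using mediate_comp [OF cp, of x y t] iarrow_mediate [OF assms(1,2)]
    iarrowD [OF assms(1)] iarrowD [OF assms(2)] assms(3,4)
  by (simp add: icmp_def)

lemma icmp_eqI:
  assumes "w \<in> Arr B" "Cod B w = Dom B (cp1 C)" "cp1 C \<cdot> w = x" "cp2 C \<cdot> w = y"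
  shows "icmp B C x y = icomp C \<cdot> w"
  unfolding icmp_def using mediate_eqI [OF cp] assms by simp

section \<open>Hom-objects as subobjects of the object of morphisms\<close>

lemma hom_pullback:
  assumes "X \<in> hom B (One B) (C0 C)" "Y \<in> hom B (One B) (C0 C)"
  shows "is_pullback B (pair B (idom C) (icod C)) (pair B X Y) (hom_leg1 B C X Y) (hom_leg2 B C X Y)"
  unfolding hom_leg1_def hom_leg2_def using assms by (intro chosen_pullback) auto

text \<open>The projection \<open>b\<close> ends in the terminal object and carries no information,
  while \<open>e\<close> is the generic arrow from \<open>X\<close> to \<open>Y\<close>. The
  pullback is arbitrary because the object \<open>D\<close> of the diagonal construction is a
  hom-object only up to isomorphism.\<close>

lemma hom_object_iarrow:
  assumes XY: "X \<in> hom B (One B) (C0 C)" "Y \<in> hom B (One B) (C0 C)"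
    and pb: "is_pullback B (pair B (idom C) (icod C)) (pair B X Y) e b"
  shows "b = bang B (Dom B e)"
    and "iarrow B C (Dom B e) (X \<cdot> bang B (Dom B e)) (Y \<cdot> bang B (Dom B e)) e"
proof -
  note a = pullback_arr [OF pb]
  show b: "b = bang B (Dom B e)"
    using bang_unique [of b] a XY by simp
  have e: "e \<in> Arr B" "Cod B e = C1 C"
    using a by auto
  have eq: "pair B (idom C) (icod C) \<cdot> e = pair B X Y \<cdot> bang B (Dom B e)"
    using a b by simp
  have "idom C \<cdot> e = prod1 B (C0 C) (C0 C) \<cdot> (pair B (idom C) (icod C) \<cdot> e)"
    using e by (simp add: pair_comp)
  also have "\<dots> = X \<cdot> bang B (Dom B e)"
    unfolding eq using e XY by (simp add: pair_comp)
  finally have 1: "idom C \<cdot> e = X \<cdot> bang B (Dom B e)" .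
  have "icod C \<cdot> e = prod2 B (C0 C) (C0 C) \<cdot> (pair B (idom C) (icod C) \<cdot> e)"
    using e by (simp add: pair_comp)
  also have "\<dots> = Y \<cdot> bang B (Dom B e)"
    unfolding eq using e XY by (simp add: pair_comp)
  finally show "iarrow B C (Dom B e) (X \<cdot> bang B (Dom B e)) (Y \<cdot> bang B (Dom B e)) e"
    using 1 e unfolding iarrow_def by simp
qed

lemma hom_object_square:
  assumes XY: "X \<in> hom B (One B) (C0 C)" "Y \<in> hom B (One B) (C0 C)"
    and x: "iarrow B C T (X \<cdot> bang B T) (Y \<cdot> bang B T) x"
  shows "pair B (idom C) (icod C) \<cdot> x = pair B X Y \<cdot> bang B T"
  using iarrowD [OF x] XY by (simp add: pair_comp)

lemma hom_leg:
  assumes XY: "X \<in> hom B (One B) (C0 C)" "Y \<in> hom B (One B) (C0 C)"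
  shows "iarrow B C (hom_obj B C X Y) (X \<cdot> bang B (hom_obj B C X Y)) (Y \<cdot> bang B (hom_obj B C X Y))
      (hom_leg1 B C X Y)"
    and "hom_leg2 B C X Y = bang B (hom_obj B C X Y)"
  using hom_object_iarrow [OF XY hom_pullback [OF XY]] by (simp_all add: hom_obj_def)

lemma hom_lift:
  assumes XY: "X \<in> hom B (One B) (C0 C)" "Y \<in> hom B (One B) (C0 C)"
    and x: "iarrow B C T (X \<cdot> bang B T) (Y \<cdot> bang B T) x"
  shows "hom_lift B C X Y x \<in> Arr B" "Dom B (hom_lift B C X Y x) = T"
    "Cod B (hom_lift B C X Y x) = hom_obj B C X Y" "hom_leg1 B C X Y \<cdot> hom_lift B C X Y x = x"
  using mediate [OF hom_pullback [OF XY], of x "bang B T"] hom_object_square [OF XY x]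
    iarrowD [OF x] XY
  by (auto simp: hom_lift_def hom_obj_def)

text \<open>The other projection ends in the terminal object, so \<open>e\<close> alone separates
  arrows.\<close>

lemma hom_object_mono:
  assumes XY: "X \<in> hom B (One B) (C0 C)" "Y \<in> hom B (One B) (C0 C)"
    and pb: "is_pullback B (pair B (idom C) (icod C)) (pair B X Y) e b"
    and uv: "u \<in> hom B T (Dom B e)" "v \<in> hom B T (Dom B e)" "e \<cdot> u = e \<cdot> v"
  shows "u = v"
proof (rule pullback_eqI [OF pb])
  have "e \<in> Arr B"
    using pullback_arr [OF pb] by simp
  then show "b \<cdot> u = b \<cdot> v"
    unfolding hom_object_iarrow(1) [OF XY pb] using uv(1,2) by simp
qed (use uv in simp_all)

lemma hom_leg_mono:
  assumes XY: "X \<in> hom B (One B) (C0 C)" "Y \<in> hom B (One B) (C0 C)"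
    and uv: "u \<in> hom B T (hom_obj B C X Y)" "v \<in> hom B T (hom_obj B C X Y)"
      "hom_leg1 B C X Y \<cdot> u = hom_leg1 B C X Y \<cdot> v"
  shows "u = v"
  using hom_object_mono [OF XY hom_pullback [OF XY]] uv by (simp add: hom_obj_def)

end


locale int_cat = fl_cat B for B :: "('o, 'm, 'z) fl_category_scheme" (structure) +
  fixes C :: "('o, 'm) fl_icat"
  assumes fl_icat: "is_fl_icat B C"
begin

lemma icat: "is_icat B C" "is_iterminal B C" "is_ipullback B C"
  using fl_icat by (simp_all add: is_fl_icat_def)

sublocale comp_graph B C
  using icat(1) by unfold_locales (simp_all add: is_icat_def)

lemma iid [simp]: "iid C \<in> Arr B" "Dom B (iid C) = C0 C" "Cod B (iid C) = C1 C"
  using icat(1) by (simp_all add: is_icat_def)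

lemma iid_iarrow:
  assumes "X \<in> hom B T (C0 C)"
  shows "iarrow B C T X X (iid C \<cdot> X)"
  using comp_extend [of "idom C" "iid C" "Idn B (C0 C)" X]
    comp_extend [of "icod C" "iid C" "Idn B (C0 C)" X] assms icat(1)
  by (auto simp: iarrow_def is_icat_def)

lemma icmp_iarrow:
  assumes x: "iarrow B C T X Y x" and y: "iarrow B C T Y Z y"
  shows "iarrow B C T X Z (icmp B C x y)"
proof -
  note m = iarrow_mediate [OF x y]
  have d: "idom C \<cdot> icomp C = idom C \<cdot> cp1 C" and c: "icod C \<cdot> icomp C = icod C \<cdot> cp2 C"
    using icat(1) by (simp_all add: is_icat_def)
  have "idom C \<cdot> icmp B C x y = idom C \<cdot> x"
    using square_extend [OF d, of "mediate B (cp1 C) (cp2 C) x y"] m by (simp add: icmp_def)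
  moreover have "icod C \<cdot> icmp B C x y = icod C \<cdot> y"
    using square_extend [OF c, of "mediate B (cp1 C) (cp2 C) x y"] m by (simp add: icmp_def)
  ultimately show ?thesis
    using icmp_arr [OF x y] iarrowD(4) [OF x] iarrowD(5) [OF y] by (simp add: iarrow_def)
qed

text \<open>The axiom is the unit law for the generic arrow, the identity of \<open>C1 C\<close>;
  precomposition with \<open>x\<close> gives every instance.\<close>

lemma iid_icmp:
  assumes x: "iarrow B C T X Y x"
  shows "icmp B C (iid C \<cdot> X) x = x"
proof -
  note xx = iarrowD [OF x]
  have 1: "iarrow B C (C1 C) (idom C) (idom C) (iid C \<cdot> idom C)"
    by (rule iid_iarrow) simp
  have 2: "iarrow B C (C1 C) (idom C) (icod C) (Idn B (C1 C))"
    by (simp add: iarrow_def)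
  have "icmp B C (iid C \<cdot> idom C) (Idn B (C1 C)) \<cdot> x = Idn B (C1 C) \<cdot> x"
    using icat(1) by (simp add: is_icat_def)
  then show ?thesis
    using icmp_comp [OF 1 2, of x] xx by simp
qed

lemma icmp_iid:
  assumes x: "iarrow B C T X Y x"
  shows "icmp B C x (iid C \<cdot> Y) = x"
proof -
  note xx = iarrowD [OF x]
  have 1: "iarrow B C (C1 C) (idom C) (icod C) (Idn B (C1 C))"
    by (simp add: iarrow_def)
  have 2: "iarrow B C (C1 C) (icod C) (icod C) (iid C \<cdot> icod C)"
    by (rule iid_iarrow) simp
  have "icmp B C (Idn B (C1 C)) (iid C \<cdot> icod C) \<cdot> x = Idn B (C1 C) \<cdot> x"
    using icat(1) by (simp add: is_icat_def)
  then show ?thesis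
    using icmp_comp [OF 1 2, of x] xx by simp
qed

lemma icmp_assoc:
  assumes x: "iarrow B C T W X x" and y: "iarrow B C T X Y y" and z: "iarrow B C T Y Z z"
  shows "icmp B C (icmp B C x y) z = icmp B C x (icmp B C y z)"
proof -
  let ?fg = "Pb1 B (cp2 C) (cp1 C)" and ?gh = "Pb2 B (cp2 C) (cp1 C)"
  have t: "is_pullback B (cp2 C) (cp1 C) ?fg ?gh"
    by (intro chosen_pullback) auto
  note ta = pullback_arr [OF t]
  note xy = iarrow_mediate [OF x y] and yz = iarrow_mediate [OF y z]
  \<comment> \<open>\<open>w\<close> classifies the composable triple \<open>x\<close>,
    \<open>y\<close>, \<open>z\<close>; the associativity axiom, stated for the generic triple, is
    precomposed with it.\<close>
  define w where "w = mediate B ?fg ?gh (mediate B (cp1 C) (cp2 C) x y) (mediate B (cp1 C) (cp2 C) y z)"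
  have w: "w \<in> Arr B" "Dom B w = T" "Cod B w = Dom B ?fg"
    "?fg \<cdot> w = mediate B (cp1 C) (cp2 C) x y" "?gh \<cdot> w = mediate B (cp1 C) (cp2 C) y z"
    using mediate [OF t, of "mediate B (cp1 C) (cp2 C) x y" "mediate B (cp1 C) (cp2 C) y z"] xy yz
    unfolding w_def by auto
  have d: "idom C \<cdot> icomp C = idom C \<cdot> cp1 C" and c: "icod C \<cdot> icomp C = icod C \<cdot> cp2 C"
    and cd: "icod C \<cdot> cp1 C = idom C \<cdot> cp2 C"
    using icat(1) pullback_arr(9) [OF cp] by (simp_all add: is_icat_def)
  have "icod C \<cdot> (icomp C \<cdot> ?fg) = icod C \<cdot> (cp2 C \<cdot> ?fg)"
    using ta by (intro square_extend [OF c]) auto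
  also have "\<dots> = icod C \<cdot> (cp1 C \<cdot> ?gh)"
    using ta by simp
  also have "\<dots> = idom C \<cdot> (cp2 C \<cdot> ?gh)"
    using ta by (intro square_extend [OF cd]) auto
  finally have 1: "icod C \<cdot> (icomp C \<cdot> ?fg) = idom C \<cdot> (cp2 C \<cdot> ?gh)" .
  have "icod C \<cdot> (cp1 C \<cdot> ?fg) = idom C \<cdot> (cp2 C \<cdot> ?fg)"
    using ta by (intro square_extend [OF cd]) auto
  also have "\<dots> = idom C \<cdot> (cp1 C \<cdot> ?gh)"
    using ta by simp
  also have "\<dots> = idom C \<cdot> (icomp C \<cdot> ?gh)"
    using ta by (intro square_extend [OF d [symmetric]]) auto
  finally have 2: "icod C \<cdot> (cp1 C \<cdot> ?fg) = idom C \<cdot> (icomp C \<cdot> ?gh)" .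
  have G: "iarrow B C (Dom B ?fg) (idom C \<cdot> (icomp C \<cdot> ?fg)) (icod C \<cdot> (icomp C \<cdot> ?fg)) (icomp C \<cdot> ?fg)"
    "iarrow B C (Dom B ?fg) (icod C \<cdot> (icomp C \<cdot> ?fg)) (icod C \<cdot> (cp2 C \<cdot> ?gh)) (cp2 C \<cdot> ?gh)"
    "iarrow B C (Dom B ?fg) (idom C \<cdot> (cp1 C \<cdot> ?fg)) (icod C \<cdot> (cp1 C \<cdot> ?fg)) (cp1 C \<cdot> ?fg)"
    "iarrow B C (Dom B ?fg) (icod C \<cdot> (cp1 C \<cdot> ?fg)) (icod C \<cdot> (icomp C \<cdot> ?gh)) (icomp C \<cdot> ?gh)"
    using ta 1 2 by (simp_all add: iarrow_def)
  have "icmp B C (icomp C \<cdot> ?fg) (cp2 C \<cdot> ?gh) \<cdot> w = icmp B C (cp1 C \<cdot> ?fg) (icomp C \<cdot> ?gh) \<cdot> w"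
    using icat(1) by (simp add: is_icat_def Let_def)
  moreover have "icmp B C (icomp C \<cdot> ?fg) (cp2 C \<cdot> ?gh) \<cdot> w = icmp B C (icmp B C x y) z"
    using icmp_comp [OF G(1) G(2) w(1)] ta w xy yz by (simp add: icmp_def)
  moreover have "icmp B C (cp1 C \<cdot> ?fg) (icomp C \<cdot> ?gh) \<cdot> w = icmp B C x (icmp B C y z)"
    using icmp_comp [OF G(3) G(4) w(1)] ta w xy yz by (simp add: icmp_def)
  ultimately show ?thesis
    by simp
qed

text \<open>Under the embeddings into \<open>C1 C\<close>, composition of hom-objects becomes
  \<open>icmp\<close>; this equation stands in for the definition from here on.\<close>

lemma hom_comp:
  assumes XYZ: "X \<in> hom B (One B) (C0 C)" "Y \<in> hom B (One B) (C0 C)" "Z \<in> hom B (One B) (C0 C)"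
    and u: "u \<in> hom B T (hom_obj B C X Y)" and v: "v \<in> hom B T (hom_obj B C Y Z)"
  shows "hom_comp B C X Y Z \<cdot> pair B u v \<in> hom B T (hom_obj B C X Z)"
    and "hom_leg1 B C X Z \<cdot> (hom_comp B C X Y Z \<cdot> pair B u v) =
      icmp B C (hom_leg1 B C X Y \<cdot> u) (hom_leg1 B C Y Z \<cdot> v)"
proof -
  let ?p = "prod1 B (hom_obj B C X Y) (hom_obj B C Y Z)"
  let ?q = "prod2 B (hom_obj B C X Y) (hom_obj B C Y Z)"
  note lx = hom_leg(1) [OF XYZ(1,2)] and ly = hom_leg(1) [OF XYZ(2,3)]
  have o: "hom_obj B C X Y \<in> Obj B" "hom_obj B C Y Z \<in> Obj B"
    using iarrowD(6) [OF lx] iarrowD(6) [OF ly] .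
  have x: "iarrow B C (Dom B ?p) (X \<cdot> bang B (Dom B ?p)) (Y \<cdot> bang B (Dom B ?p)) (hom_leg1 B C X Y \<cdot> ?p)"
    using iarrow_comp [OF lx, of ?p] XYZ o by simp
  have y: "iarrow B C (Dom B ?p) (Y \<cdot> bang B (Dom B ?p)) (Z \<cdot> bang B (Dom B ?p)) (hom_leg1 B C Y Z \<cdot> ?q)"
    using iarrow_comp [OF ly, of ?q] XYZ o by simp
  note l = hom_lift [OF XYZ(1,3) icmp_iarrow [OF x y], folded hom_comp_def]
  note lxz = iarrowD [OF hom_leg(1) [OF XYZ(1,3)]]
  have w: "pair B u v \<in> Arr B" "Dom B (pair B u v) = T" "Cod B (pair B u v) = Dom B ?p"
    "?p \<cdot> pair B u v = u" "?q \<cdot> pair B u v = v"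
    using u v by auto
  show "hom_comp B C X Y Z \<cdot> pair B u v \<in> hom B T (hom_obj B C X Z)"
    using l w by simp
  have "hom_leg1 B C X Z \<cdot> (hom_comp B C X Y Z \<cdot> pair B u v) =
      icmp B C (hom_leg1 B C X Y \<cdot> ?p) (hom_leg1 B C Y Z \<cdot> ?q) \<cdot> pair B u v"
    using lxz(1-3) l(1-3) w(1-3) by (intro comp_extend l(4)) auto
  also have "\<dots> = icmp B C (hom_leg1 B C X Y \<cdot> (?p \<cdot> pair B u v)) (hom_leg1 B C Y Z \<cdot> (?q \<cdot> pair B u v))"
    using icmp_comp [OF x y w(1,3)] iarrowD(1-3) [OF lx] iarrowD(1-3) [OF ly] o w(1-3) by simp
  finally show "hom_leg1 B C X Z \<cdot> (hom_comp B C X Y Z \<cdot> pair B u v) =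
      icmp B C (hom_leg1 B C X Y \<cdot> u) (hom_leg1 B C Y Z \<cdot> v)"
    using w by simp
qed

section \<open>Internal terminal object and internal pullbacks\<close>

lemma iter [simp]: "iter C \<in> Arr B" "Dom B (iter C) = One B" "Cod B (iter C) = C0 C"
  using icat(2) by (simp_all add: is_iterminal_def)

lemma ibang_unique:
  assumes v: "iarrow B C T X (iter C \<cdot> bang B T) v"
  shows "v = ibang C \<cdot> X"
proof -
  let ?v = "Pb1 B (icod C) (iter C)"
  have pb: "is_pullback B (icod C) (iter C) ?v (Pb2 B (icod C) (iter C))"
    by (intro chosen_pullback) auto
  note a = pullback_arr [OF pb] and vv = iarrowD [OF v]
  let ?w = "mediate B ?v (Pb2 B (icod C) (iter C)) v (bang B T)"
  have w: "?w \<in> Arr B" "Cod B ?w = Dom B ?v" "?v \<cdot> ?w = v"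
    using mediate [OF pb, of v "bang B T"] vv by auto
  have ib: "ibang C \<in> Arr B" "Dom B (ibang C) = C0 C" "ibang C \<cdot> (idom C \<cdot> ?v) = ?v"
    using icat(2) by (simp_all add: is_iterminal_def Let_def)
  have "ibang C \<cdot> (idom C \<cdot> (?v \<cdot> ?w)) = ?v \<cdot> ?w"
    using comp_extend [OF ib(3), of ?w] a w ib by simp
  then show ?thesis
    using w(3) vv(4) by simp
qed

lemma cs: "is_pullback B (icod C) (icod C) (cs1 C) (cs2 C)"
  and sq: "is_pullback B (icomp C) (icomp C) (sq1 C) (sq2 C)"
  using icat(3) by (simp_all add: is_ipullback_def)

lemma cs_arr [simp]: "cs1 C \<in> Arr B" "Cod B (cs1 C) = C1 C"
    "cs2 C \<in> Arr B" "Dom B (cs2 C) = Dom B (cs1 C)" "Cod B (cs2 C) = C1 C"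
  using pullback_arr [OF cs] by simp_all

lemma sq_arr [simp]: "sq1 C \<in> Arr B" "Cod B (sq1 C) = Dom B (cp1 C)"
    "sq2 C \<in> Arr B" "Dom B (sq2 C) = Dom B (sq1 C)" "Cod B (sq2 C) = Dom B (cp1 C)"
  using pullback_arr [OF sq] by simp_all

lemma ipb_arr [simp]: "ipb1 C \<in> Arr B" "Dom B (ipb1 C) = Dom B (cs1 C)" "Cod B (ipb1 C) = C1 C"
    "ipb2 C \<in> Arr B" "Dom B (ipb2 C) = Dom B (cs1 C)" "Cod B (ipb2 C) = C1 C"
    "imed C \<in> Arr B" "Dom B (imed C) = Dom B (sq1 C)" "Cod B (imed C) = C1 C"
  using icat(3) by (simp_all add: is_ipullback_def)

lemma cospan:
  assumes "iarrow B C T X Z a" "iarrow B C T Y Z b"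
  shows "mediate B (cs1 C) (cs2 C) a b \<in> Arr B" "Dom B (mediate B (cs1 C) (cs2 C) a b) = T"
    "Cod B (mediate B (cs1 C) (cs2 C) a b) = Dom B (cs1 C)"
    "cs1 C \<cdot> mediate B (cs1 C) (cs2 C) a b = a" "cs2 C \<cdot> mediate B (cs1 C) (cs2 C) a b = b"
  using mediate [OF cs, of a b] iarrowD [OF assms(1)] iarrowD [OF assms(2)] by auto

lemma cospan_comp:
  assumes "iarrow B C T X Z a" "iarrow B C T Y Z b" "t \<in> Arr B" "Cod B t = T"
  shows "mediate B (cs1 C) (cs2 C) a b \<cdot> t = mediate B (cs1 C) (cs2 C) (a \<cdot> t) (b \<cdot> t)"
  using mediate_comp [OF cs, of a b t] iarrowD [OF assms(1)] iarrowD [OF assms(2)] assms(3,4) by auto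

lemma ipb_iarrow:
  assumes a: "iarrow B C T X Z a" and b: "iarrow B C T Y Z b"
    and s: "s = mediate B (cs1 C) (cs2 C) a b"
  shows "iarrow B C T (idom C \<cdot> (ipb1 C \<cdot> s)) X (ipb1 C \<cdot> s)"
    and "iarrow B C T (idom C \<cdot> (ipb1 C \<cdot> s)) Y (ipb2 C \<cdot> s)"
    and "icmp B C (ipb1 C \<cdot> s) a = icmp B C (ipb2 C \<cdot> s) b"
proof -
  note ss = cospan [OF a b, folded s]
  have e: "idom C \<cdot> ipb1 C = idom C \<cdot> ipb2 C" "icod C \<cdot> ipb1 C = idom C \<cdot> cs1 C"
    "icod C \<cdot> ipb2 C = idom C \<cdot> cs2 C" "icmp B C (ipb1 C) (cs1 C) = icmp B C (ipb2 C) (cs2 C)"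
    using icat(3) by (simp_all add: is_ipullback_def)
  have "icod C \<cdot> (ipb1 C \<cdot> s) = idom C \<cdot> (cs1 C \<cdot> s)" "icod C \<cdot> (ipb2 C \<cdot> s) = idom C \<cdot> (cs2 C \<cdot> s)"
    "idom C \<cdot> (ipb1 C \<cdot> s) = idom C \<cdot> (ipb2 C \<cdot> s)"
    using ss by (auto intro!: square_extend e)
  then show "iarrow B C T (idom C \<cdot> (ipb1 C \<cdot> s)) X (ipb1 C \<cdot> s)"
    "iarrow B C T (idom C \<cdot> (ipb1 C \<cdot> s)) Y (ipb2 C \<cdot> s)"
    using ss iarrowD(4) [OF a] iarrowD(4) [OF b] by (simp_all add: iarrow_def)
  have "iarrow B C (Dom B (cs1 C)) (idom C \<cdot> ipb1 C) (icod C \<cdot> ipb1 C) (ipb1 C)"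
    "iarrow B C (Dom B (cs1 C)) (icod C \<cdot> ipb1 C) (icod C \<cdot> cs1 C) (cs1 C)"
    "iarrow B C (Dom B (cs1 C)) (idom C \<cdot> ipb2 C) (icod C \<cdot> ipb2 C) (ipb2 C)"
    "iarrow B C (Dom B (cs1 C)) (icod C \<cdot> ipb2 C) (icod C \<cdot> cs2 C) (cs2 C)"
    using e by (simp_all add: iarrow_def)
  then show "icmp B C (ipb1 C \<cdot> s) a = icmp B C (ipb2 C \<cdot> s) b"
    using icmp_comp [of _ _ _ "ipb1 C" _ "cs1 C" s] icmp_comp [of _ _ _ "ipb2 C" _ "cs2 C" s] e(4) ss
    by metis
qed

lemma ipb_ex:
  assumes a: "iarrow B C T X Z a" and b: "iarrow B C T Y Z b"
    and s: "s = mediate B (cs1 C) (cs2 C) a b"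
    and h: "iarrow B C T W X h" and k: "iarrow B C T W Y k"
    and eq: "icmp B C h a = icmp B C k b"
  obtains v where "iarrow B C T W (idom C \<cdot> (ipb1 C \<cdot> s)) v"
    "icmp B C v (ipb1 C \<cdot> s) = h" "icmp B C v (ipb2 C \<cdot> s) = k"
proof -
  let ?h = "cp1 C \<cdot> sq1 C" and ?f = "cp2 C \<cdot> sq1 C" and ?k = "cp1 C \<cdot> sq2 C" and ?g = "cp2 C \<cdot> sq2 C"
  let ?s = "mediate B (cs1 C) (cs2 C) ?f ?g"
  let ?S = "Dom B (sq1 C)"
  have generic: "idom C \<cdot> imed C = idom C \<cdot> ?h" "icod C \<cdot> imed C = idom C \<cdot> (ipb1 C \<cdot> ?s)"
    "icmp B C (imed C) (ipb1 C \<cdot> ?s) = ?h" "icmp B C (imed C) (ipb2 C \<cdot> ?s) = ?k"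
    using icat(3) by (simp_all add: is_ipullback_def Let_def)
  have c: "icod C \<cdot> icomp C = icod C \<cdot> cp2 C"
    using icat(1) by (simp add: is_icat_def)
  have "icod C \<cdot> (cp2 C \<cdot> sq1 C) = icod C \<cdot> (icomp C \<cdot> sq1 C)"
    by (intro square_extend [OF c [symmetric]]) auto
  also have "\<dots> = icod C \<cdot> (icomp C \<cdot> sq2 C)"
    using pullback_arr(9) [OF sq] by simp
  also have "\<dots> = icod C \<cdot> (cp2 C \<cdot> sq2 C)"
    by (intro square_extend [OF c]) auto
  finally have cfg: "icod C \<cdot> ?f = icod C \<cdot> ?g" .
  have f: "iarrow B C ?S (idom C \<cdot> ?f) (icod C \<cdot> ?f) ?f"
    by (simp add: iarrow_def)
  have g: "iarrow B C ?S (idom C \<cdot> ?g) (icod C \<cdot> ?f) ?g"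
    unfolding cfg by (simp add: iarrow_def)
  note ss = cospan [OF f g]
  note leg = ipb_iarrow [OF f g refl]
  have m: "iarrow B C ?S (idom C \<cdot> ?h) (idom C \<cdot> (ipb1 C \<cdot> ?s)) (imed C)"
    using generic by (simp add: iarrow_def)
  note ha = iarrow_mediate [OF h a] and kb = iarrow_mediate [OF k b]
  \<comment> \<open>\<open>q\<close> classifies the commutative square \<open>h ; a = k ; b\<close>,
    so \<open>imed C \<cdot> q\<close> is the mediating arrow and the generic equations specialize
    along \<open>q\<close>.\<close>
  define q where "q = mediate B (sq1 C) (sq2 C) (mediate B (cp1 C) (cp2 C) h a) (mediate B (cp1 C) (cp2 C) k b)"
  have q: "q \<in> Arr B" "Dom B q = T" "Cod B q = ?S"
    "sq1 C \<cdot> q = mediate B (cp1 C) (cp2 C) h a" "sq2 C \<cdot> q = mediate B (cp1 C) (cp2 C) k b"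
    using mediate [OF sq, of "mediate B (cp1 C) (cp2 C) h a" "mediate B (cp1 C) (cp2 C) k b"]
      ha kb eq unfolding q_def icmp_def by auto
  have fq: "?f \<cdot> q = a" "?g \<cdot> q = b" "?h \<cdot> q = h" "?k \<cdot> q = k"
    using q ha kb by simp_all
  have sq_eq: "?s \<cdot> q = s"
    using cospan_comp [OF f g q(1,3)] fq s by simp
  have "iarrow B C T W (idom C \<cdot> (ipb1 C \<cdot> s)) (imed C \<cdot> q)"
  proof -
    have "iarrow B C (Dom B q) ((idom C \<cdot> ?h) \<cdot> q) ((idom C \<cdot> (ipb1 C \<cdot> ?s)) \<cdot> q) (imed C \<cdot> q)"
      by (rule iarrow_comp [OF m q(1,3)])
    moreover have "(idom C \<cdot> ?h) \<cdot> q = idom C \<cdot> (?h \<cdot> q)"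
      "(idom C \<cdot> (ipb1 C \<cdot> ?s)) \<cdot> q = idom C \<cdot> (ipb1 C \<cdot> (?s \<cdot> q))"
      using q(1-3) ss by simp_all
    ultimately show ?thesis
      using fq sq_eq q(2) iarrowD(4) [OF h] by simp
  qed
  moreover have "icmp B C (imed C \<cdot> q) (ipb1 C \<cdot> s) = h"
    using icmp_comp [OF m leg(1) q(1,3)] fq q(1-3) ss unfolding generic sq_eq [symmetric] by simp
  moreover have "icmp B C (imed C \<cdot> q) (ipb2 C \<cdot> s) = k"
    using icmp_comp [OF m leg(2) q(1,3)] fq q(1-3) ss unfolding generic sq_eq [symmetric] by simp
  ultimately show ?thesis
    by (rule that)
qed

text \<open>The uniqueness axiom concerns the generic pair of an arrow into a chosen pullback and
  its cospan; it is precomposed with the arrow that classifies \<open>v\<close> and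
  \<open>s\<close>. The right-hand side sees \<open>v\<close> only through its composites with the
  legs, which is uniqueness.\<close>

lemma ipb_imed:
  assumes a: "iarrow B C T X Z a" and b: "iarrow B C T Y Z b"
    and s: "s = mediate B (cs1 C) (cs2 C) a b"
    and v: "iarrow B C T W (idom C \<cdot> (ipb1 C \<cdot> s)) v"
  shows "v = imed C \<cdot> mediate B (sq1 C) (sq2 C)
      (mediate B (cp1 C) (cp2 C) (icmp B C v (ipb1 C \<cdot> s)) a)
      (mediate B (cp1 C) (cp2 C) (icmp B C v (ipb2 C \<cdot> s)) b)"
proof -
  let ?i = "idom C \<cdot> ipb1 C"
  let ?v = "Pb1 B (icod C) ?i" and ?s = "Pb2 B (icod C) ?i"
  have pb: "is_pullback B (icod C) ?i ?v ?s"
    by (intro chosen_pullback) auto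
  note pa = pullback_arr [OF pb]
  let ?S = "Dom B ?v"
  let ?hf = "mediate B (cp1 C) (cp2 C) (icmp B C ?v (ipb1 C \<cdot> ?s)) (cs1 C \<cdot> ?s)"
  let ?kg = "mediate B (cp1 C) (cp2 C) (icmp B C ?v (ipb2 C \<cdot> ?s)) (cs2 C \<cdot> ?s)"
  have generic: "imed C \<cdot> mediate B (sq1 C) (sq2 C) ?hf ?kg = ?v"
    using icat(3) unfolding is_ipullback_def Let_def by blast
  have eq: "icod C \<cdot> (cs1 C \<cdot> ?s) = icod C \<cdot> (cs2 C \<cdot> ?s)"
    using pa by (intro square_extend pullback_arr(9) [OF cs]) auto
  have A: "iarrow B C ?S (idom C \<cdot> (cs1 C \<cdot> ?s)) (icod C \<cdot> (cs1 C \<cdot> ?s)) (cs1 C \<cdot> ?s)"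
    using pa by (simp add: iarrow_def)
  have B: "iarrow B C ?S (idom C \<cdot> (cs2 C \<cdot> ?s)) (icod C \<cdot> (cs1 C \<cdot> ?s)) (cs2 C \<cdot> ?s)"
    unfolding eq using pa by (simp add: iarrow_def)
  have S: "?s = mediate B (cs1 C) (cs2 C) (cs1 C \<cdot> ?s) (cs2 C \<cdot> ?s)"
    using pa by (intro mediate_eqI [OF cs, symmetric]) auto
  note P = ipb_iarrow [OF A B S]
  have V: "iarrow B C ?S (idom C \<cdot> ?v) (idom C \<cdot> (ipb1 C \<cdot> ?s)) ?v"
    using pa by (simp add: iarrow_def)
  note VP = icmp_iarrow [OF V P(1)] icmp_iarrow [OF V P(2)]
  note hf = iarrow_mediate [OF VP(1) A] and kg = iarrow_mediate [OF VP(2) B]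
  have hfkg: "icomp C \<cdot> ?hf = icomp C \<cdot> ?kg"
    using icmp_assoc [OF V P(1) A] icmp_assoc [OF V P(2) B] P(3) by (simp add: icmp_def)
  note ss = cospan [OF a b, folded s] and vv = iarrowD [OF v]
  let ?w = "mediate B ?v ?s v s"
  have w: "?w \<in> Arr B" "Dom B ?w = T" "Cod B ?w = ?S" "?v \<cdot> ?w = v" "?s \<cdot> ?w = s"
    using mediate [OF pb, of v s] ss vv by auto
  have hfw: "?hf \<cdot> ?w = mediate B (cp1 C) (cp2 C) (icmp B C v (ipb1 C \<cdot> s)) a"
    using mediate_comp [OF cp, of "icmp B C ?v (ipb1 C \<cdot> ?s)" "cs1 C \<cdot> ?s" ?w]
      iarrowD [OF VP(1)] iarrowD [OF A] icmp_comp [OF V P(1) w(1,3)] w ss pa by simp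
  have kgw: "?kg \<cdot> ?w = mediate B (cp1 C) (cp2 C) (icmp B C v (ipb2 C \<cdot> s)) b"
    using mediate_comp [OF cp, of "icmp B C ?v (ipb2 C \<cdot> ?s)" "cs2 C \<cdot> ?s" ?w]
      iarrowD [OF VP(2)] iarrowD [OF B] icmp_comp [OF V P(2) w(1,3)] w ss pa by simp
  have m: "mediate B (sq1 C) (sq2 C) ?hf ?kg \<in> Arr B"
    "Dom B (mediate B (sq1 C) (sq2 C) ?hf ?kg) = ?S"
    "Cod B (mediate B (sq1 C) (sq2 C) ?hf ?kg) = Dom B (sq1 C)"
    "mediate B (sq1 C) (sq2 C) ?hf ?kg \<cdot> ?w = mediate B (sq1 C) (sq2 C) (?hf \<cdot> ?w) (?kg \<cdot> ?w)"
    using mediate [OF sq, of ?hf ?kg] mediate_comp [OF sq, of ?hf ?kg ?w] hf(1-3) kg(1-3) hfkg w(1-3)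
    by simp_all
  show ?thesis
    using comp_extend [OF generic, of ?w] m w hfw kgw by simp
qed

lemma ipb_unique:
  assumes a: "iarrow B C T X Z a" and b: "iarrow B C T Y Z b"
    and s: "s = mediate B (cs1 C) (cs2 C) a b"
    and v: "iarrow B C T W (idom C \<cdot> (ipb1 C \<cdot> s)) v" "iarrow B C T W (idom C \<cdot> (ipb1 C \<cdot> s)) v'"
    and eq: "icmp B C v (ipb1 C \<cdot> s) = icmp B C v' (ipb1 C \<cdot> s)"
      "icmp B C v (ipb2 C \<cdot> s) = icmp B C v' (ipb2 C \<cdot> s)"
  shows "v = v'"
  using ipb_imed [OF a b s v(1)] ipb_imed [OF a b s v(2)] eq by simp

end


section \<open>The functor \<open>\<box>\<close> of a pre-geminal category\<close>

locale pre_geminal_cat = int_cat B C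
  for B :: "('o, 'm, 'z) fl_category_scheme" (structure) and C :: "('o, 'm) fl_icat" +
  fixes F :: "('o, 'm, 'm, 'm) functr" and H :: "'m ifunctor"
  assumes pre_geminal: "pre_geminal B C F H"
begin

abbreviation box_obj ("\<box>\<^sub>o") where "\<box>\<^sub>o \<equiv> FO (box B C F)"
abbreviation box_arr ("\<box>\<^sub>a") where "\<box>\<^sub>a \<equiv> FA (box B C F)"
abbreviation boxC ("\<box>\<^sub>C") where "\<box>\<^sub>C \<equiv> box_icat B C F"
abbreviation leg ("\<l>") where "\<l> A \<equiv> hom_leg1 B C (iter C) (FO F A)"
abbreviation sigma ("\<sigma>") where "\<sigma> A \<equiv> box_quote B C F H A"

lemma F_functor: "is_functor B (Gam B C) F"
  and F_limits: "strictly_preserves_limits B (Gam B C) F"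
  and H_functor: "is_ifunctor B C \<box>\<^sub>C H"
  and H_F: "functor_eq B (functor_comp (Gam_functor B H) F) (functor_comp (sharp B B (box B C F)) F)"
  using pre_geminal by (simp_all add: pre_geminal_def)

lemma F_obj [simp]:
  assumes "X \<in> Obj B"
  shows "FO F X \<in> Arr B" "Dom B (FO F X) = One B" "Cod B (FO F X) = C0 C"
  using F_functor assms by (simp_all add: is_functor_def Gam_def)

lemma F_arr:
  assumes "f \<in> Arr B"
  shows "iarrow B C (One B) (FO F (Dom B f)) (FO F (Cod B f)) (FA F f)"
proof -
  have "FA F f \<in> hom (Gam B C) (FO F (Dom B f)) (FO F (Cod B f))"
    using F_functor assms by (simp only: is_functor_def)
  then show ?thesis
    by (simp add: iarrow_def hom_def Gam_def)
qed

lemma F_arr_simps [simp]: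
  assumes "f \<in> Arr B"
  shows "FA F f \<in> Arr B" "Dom B (FA F f) = One B" "Cod B (FA F f) = C1 C"
    "idom C \<cdot> FA F f = FO F (Dom B f)" "icod C \<cdot> FA F f = FO F (Cod B f)"
  using iarrowD [OF F_arr [OF assms]] by auto

lemma F_idn: "X \<in> Obj B \<Longrightarrow> FA F (Idn B X) = iid C \<cdot> FO F X"
  using F_functor by (simp add: is_functor_def Gam_def)

lemma F_comp:
  "f \<in> Arr B \<Longrightarrow> g \<in> Arr B \<Longrightarrow> Cod B f = Dom B g \<Longrightarrow> FA F (g \<cdot> f) = icmp B C (FA F f) (FA F g)"
  using F_functor by (simp add: is_functor_def Gam_def)

lemma F_one: "FO F (One B) = iter C"
  using F_limits by (simp add: strictly_preserves_limits_def Gam_def)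

lemma F_pb:
  assumes "f \<in> Arr B" "g \<in> Arr B" "Cod B f = Cod B g"
  shows "FA F (Pb1 B f g) = ipb1 C \<cdot> mediate B (cs1 C) (cs2 C) (FA F f) (FA F g)"
    "FA F (Pb2 B f g) = ipb2 C \<cdot> mediate B (cs1 C) (cs2 C) (FA F f) (FA F g)"
  using F_limits assms by (simp_all add: strictly_preserves_limits_def Gam_def)

lemma F_const:
  assumes "f \<in> Arr B" "T \<in> Obj B"
  shows "iarrow B C T (FO F (Dom B f) \<cdot> bang B T) (FO F (Cod B f) \<cdot> bang B T) (FA F f \<cdot> bang B T)"
  using iarrow_comp [OF F_arr, of f "bang B T"] assms by simp

lemma iter_hom: "iter C \<in> hom B (One B) (C0 C)"
  by simp

lemma F_hom: "X \<in> Obj B \<Longrightarrow> FO F X \<in> hom B (One B) (C0 C)"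
  by simp

lemma box_obj_hom: "\<box>\<^sub>o A = hom_obj B C (iter C) (FO F A)"
  by (simp add: box_def functor_comp_def global_sections_def)

lemma leg_iarrow:
  assumes "A \<in> Obj B"
  shows "iarrow B C (\<box>\<^sub>o A) (iter C \<cdot> bang B (\<box>\<^sub>o A)) (FO F A \<cdot> bang B (\<box>\<^sub>o A)) (\<l> A)"
  unfolding box_obj_hom using hom_leg(1) [OF iter_hom F_hom [OF assms]] .

lemma box_obj [simp]: "A \<in> Obj B \<Longrightarrow> \<box>\<^sub>o A \<in> Obj B"
  using iarrowD(6) [OF leg_iarrow] .

lemma leg [simp]:
  assumes "A \<in> Obj B"
  shows "\<l> A \<in> Arr B" "Dom B (\<l> A) = \<box>\<^sub>o A" "Cod B (\<l> A) = C1 C"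
  using iarrowD [OF leg_iarrow [OF assms]] by auto

lemma leg_comp:
  assumes "A \<in> Obj B" "t \<in> hom B T (\<box>\<^sub>o A)"
  shows "iarrow B C T (iter C \<cdot> bang B T) (FO F A \<cdot> bang B T) (\<l> A \<cdot> t)"
  using iarrow_comp [OF leg_iarrow, of A t] assms by auto

lemma leg_lift:
  assumes "A \<in> Obj B" "iarrow B C T (iter C \<cdot> bang B T) (FO F A \<cdot> bang B T) x"
  obtains t where "t \<in> hom B T (\<box>\<^sub>o A)" "\<l> A \<cdot> t = x"
  using hom_lift [OF iter_hom F_hom [OF assms(1)] assms(2)] by (auto simp: box_obj_hom)

lemma leg_mono:
  assumes "A \<in> Obj B" "u \<in> hom B T (\<box>\<^sub>o A)" "v \<in> hom B T (\<box>\<^sub>o A)" "\<l> A \<cdot> u = \<l> A \<cdot> v"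
  shows "u = v"
  using hom_leg_mono [OF iter_hom F_hom [OF assms(1)], of u T v] assms by (simp add: box_obj_hom)

text \<open>The definition composes with the element of a hom-object that names
  \<open>FA F f\<close>; the embedding into \<open>C1 C\<close> removes the name again, so \<box>
  acts by composition with the constant arrow \<open>F f\<close>.\<close>

lemma box_arr_leg:
  assumes f: "f \<in> Arr B"
  shows "\<box>\<^sub>a f \<in> hom B (\<box>\<^sub>o (Dom B f)) (\<box>\<^sub>o (Cod B f))"
    and "\<l> (Cod B f) \<cdot> \<box>\<^sub>a f = icmp B C (\<l> (Dom B f)) (FA F f \<cdot> bang B (\<box>\<^sub>o (Dom B f)))"
proof -
  let ?S = "\<box>\<^sub>o (Dom B f)"
  let ?X = "FO F (Dom B f)" and ?Y = "FO F (Cod B f)"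
  have X: "?X \<in> hom B (One B) (C0 C)" and Y: "?Y \<in> hom B (One B) (C0 C)"
    using f by auto
  let ?n = "hom_lift B C ?X ?Y (FA F f)"
  have e: "\<box>\<^sub>a f = hom_comp B C (iter C) ?X ?Y \<cdot> pair B (Idn B ?S) (?n \<cdot> bang B ?S)"
    using f by (simp add: box_def functor_comp_def global_sections_def Let_def)
  have n: "?n \<in> Arr B" "Dom B ?n = One B" "Cod B ?n = hom_obj B C ?X ?Y" "hom_leg1 B C ?X ?Y \<cdot> ?n = FA F f"
    using hom_lift [OF X Y F_const [OF f one_obj, simplified]] f by simp_all
  note l = iarrowD(1-3) [OF hom_leg(1) [OF X Y]]
  have u: "Idn B ?S \<in> hom B ?S (hom_obj B C (iter C) ?X)"
    using f box_obj [of "Dom B f"] by (simp add: box_obj_hom)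
  have v: "?n \<cdot> bang B ?S \<in> hom B ?S (hom_obj B C ?X ?Y)"
    using f n by simp
  show "\<box>\<^sub>a f \<in> hom B (\<box>\<^sub>o (Dom B f)) (\<box>\<^sub>o (Cod B f))"
    using hom_comp(1) [OF iter_hom X Y u v] unfolding e box_obj_hom .
  have "hom_leg1 B C ?X ?Y \<cdot> (?n \<cdot> bang B ?S) = FA F f \<cdot> bang B ?S"
    using f n l by (intro comp_extend) auto
  then show "\<l> (Cod B f) \<cdot> \<box>\<^sub>a f = icmp B C (\<l> (Dom B f)) (FA F f \<cdot> bang B (\<box>\<^sub>o (Dom B f)))"
    using hom_comp(2) [OF iter_hom X Y u v] f unfolding e by simp
qed

lemma box_arr [simp]:
  assumes "f \<in> Arr B"
  shows "\<box>\<^sub>a f \<in> Arr B" "Dom B (\<box>\<^sub>a f) = \<box>\<^sub>o (Dom B f)" "Cod B (\<box>\<^sub>a f) = \<box>\<^sub>o (Cod B f)"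
  using box_arr_leg(1) [OF assms] by simp_all

lemma leg_box_arr:
  assumes f: "f \<in> hom B A A'" and t: "t \<in> hom B T (\<box>\<^sub>o A)"
  shows "\<l> A' \<cdot> (\<box>\<^sub>a f \<cdot> t) = icmp B C (\<l> A \<cdot> t) (FA F f \<cdot> bang B T)"
proof -
  have f': "f \<in> Arr B" "Dom B f = A" "Cod B f = A'" and A: "A \<in> Obj B" "A' \<in> Obj B" "\<box>\<^sub>o A \<in> Obj B"
    using f by auto
  have "\<l> A' \<cdot> (\<box>\<^sub>a f \<cdot> t) = icmp B C (\<l> A) (FA F f \<cdot> bang B (\<box>\<^sub>o A)) \<cdot> t"
    using box_arr_leg(2) [OF f'(1)] f' A t by (intro comp_extend) auto
  also have "\<dots> = icmp B C (\<l> A \<cdot> t) (FA F f \<cdot> bang B T)"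
    using icmp_comp [OF leg_iarrow [OF A(1)] F_const [OF f'(1) A(3), unfolded f'], of t] t f' A by simp
  finally show ?thesis .
qed

section \<open>Functoriality and preservation of pullbacks\<close>

lemma box_idn: "A \<in> Obj B \<Longrightarrow> \<box>\<^sub>a (Idn B A) = Idn B (\<box>\<^sub>o A)"
proof (rule leg_mono [of A _ "\<box>\<^sub>o A"])
  assume A: "A \<in> Obj B"
  then show "\<l> A \<cdot> \<box>\<^sub>a (Idn B A) = \<l> A \<cdot> Idn B (\<box>\<^sub>o A)"
    using icmp_iid [OF leg_iarrow [OF A]] box_arr_leg(2) [of "Idn B A"] by (simp add: F_idn)
qed simp_all

lemma box_comp:
  assumes f: "f \<in> Arr B" and g: "g \<in> Arr B" and eq: "Cod B f = Dom B g"
  shows "\<box>\<^sub>a (g \<cdot> f) = \<box>\<^sub>a g \<cdot> \<box>\<^sub>a f"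
proof (rule leg_mono [of "Cod B g" _ "\<box>\<^sub>o (Dom B f)"])
  let ?S = "\<box>\<^sub>o (Dom B f)"
  have S: "?S \<in> Obj B"
    using f by simp
  have Ff: "iarrow B C (One B) (FO F (Dom B f)) (FO F (Dom B g)) (FA F f)"
    using F_arr [OF f] eq by simp
  have Ffg: "FA F (g \<cdot> f) \<cdot> bang B ?S = icmp B C (FA F f \<cdot> bang B ?S) (FA F g \<cdot> bang B ?S)"
    using icmp_comp [OF Ff F_arr [OF g], of "bang B ?S"] f g eq by (simp add: F_comp)
  have "\<l> (Cod B g) \<cdot> \<box>\<^sub>a (g \<cdot> f) = icmp B C (\<l> (Dom B f)) (FA F (g \<cdot> f) \<cdot> bang B ?S)"
    using box_arr_leg(2) [of "g \<cdot> f"] f g eq by simp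
  also have "\<dots> = icmp B C (icmp B C (\<l> (Dom B f)) (FA F f \<cdot> bang B ?S)) (FA F g \<cdot> bang B ?S)"
    unfolding Ffg using F_const [OF f S] F_const [OF g S] leg_iarrow [of "Dom B f"] f eq
    by (intro icmp_assoc [symmetric]) auto
  also have "\<dots> = icmp B C (\<l> (Dom B g) \<cdot> \<box>\<^sub>a f) (FA F g \<cdot> bang B ?S)"
    using box_arr_leg(2) [OF f] eq by simp
  also have "\<dots> = \<l> (Cod B g) \<cdot> (\<box>\<^sub>a g \<cdot> \<box>\<^sub>a f)"
    using f g eq by (intro leg_box_arr [symmetric]) auto
  finally show "\<l> (Cod B g) \<cdot> \<box>\<^sub>a (g \<cdot> f) = \<l> (Cod B g) \<cdot> (\<box>\<^sub>a g \<cdot> \<box>\<^sub>a f)" .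
qed (use f g eq in auto)

lemma box_comp_extend:
  assumes "f \<in> Arr B" "g \<in> Arr B" "Cod B f = Dom B g" "t \<in> Arr B" "Cod B t = \<box>\<^sub>o (Dom B f)"
  shows "\<box>\<^sub>a g \<cdot> (\<box>\<^sub>a f \<cdot> t) = \<box>\<^sub>a (g \<cdot> f) \<cdot> t"
  using assms by (simp add: box_comp)

text \<open>An arrow from \<open>T\<close> into \<open>\<box>P\<close> is an internal arrow from
  \<open>1\<close> to \<open>F P\<close> at stage \<open>T\<close>. As \<open>F\<close> takes the
  chosen pullback to the chosen internal one, the universal property at \<open>T\<close> is the
  internal universal property for cones with vertex \<open>1\<close>.\<close>

lemma box_chosen_pullback:
  assumes f: "f \<in> Arr B" and g: "g \<in> Arr B" and eq: "Cod B f = Cod B g"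
  shows "is_pullback B (\<box>\<^sub>a f) (\<box>\<^sub>a g) (\<box>\<^sub>a (Pb1 B f g)) (\<box>\<^sub>a (Pb2 B f g))"
proof -
  let ?p = "Pb1 B f g" and ?q = "Pb2 B f g"
  let ?P = "Dom B ?p"
  note a = pullback_arr [OF chosen_pullback [OF f g eq]]
  have P: "?P \<in> Obj B"
    using a by simp
  have "\<exists>!u. u \<in> hom B T (Dom B (\<box>\<^sub>a ?p)) \<and> \<box>\<^sub>a ?p \<cdot> u = h \<and> \<box>\<^sub>a ?q \<cdot> u = k"
    if T: "T \<in> Obj B" and h: "h \<in> hom B T (\<box>\<^sub>o (Dom B f))" and k: "k \<in> hom B T (\<box>\<^sub>o (Dom B g))"
      and hk: "\<box>\<^sub>a f \<cdot> h = \<box>\<^sub>a g \<cdot> k" for T h k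
  proof -
    let ?f = "FA F f \<cdot> bang B T" and ?g = "FA F g \<cdot> bang B T"
    define s where "s = mediate B (cs1 C) (cs2 C) ?f ?g"
    note Ff = F_const [OF f T] and Fg = F_const [OF g T, folded eq]
    have s: "mediate B (cs1 C) (cs2 C) (FA F f) (FA F g) \<cdot> bang B T = s"
      unfolding s_def using cospan_comp [OF F_arr [OF f] F_arr [OF g, folded eq]] T by simp
    note s0 = cospan [OF F_arr [OF f] F_arr [OF g, folded eq]]
    have p: "FA F ?p \<cdot> bang B T = ipb1 C \<cdot> s" and q: "FA F ?q \<cdot> bang B T = ipb2 C \<cdot> s"
      unfolding F_pb [OF f g eq] s [symmetric] using s0 T by simp_all
    have ip: "idom C \<cdot> (ipb1 C \<cdot> s) = FO F ?P \<cdot> bang B T"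
      unfolding p [symmetric] using iarrowD(4) [OF F_const [OF a(4) T]] .
    note hh = leg_comp [OF dom_cod_obj(1) [OF f] h] and kk = leg_comp [OF dom_cod_obj(1) [OF g] k]
    have f': "f \<in> hom B (Dom B f) (Cod B f)" "g \<in> hom B (Dom B g) (Cod B f)"
      "?p \<in> hom B ?P (Dom B f)" "?q \<in> hom B ?P (Dom B g)"
      using f g eq a by auto
    have "icmp B C (\<l> (Dom B f) \<cdot> h) ?f = icmp B C (\<l> (Dom B g) \<cdot> k) ?g"
      using leg_box_arr [OF f'(1) h] leg_box_arr [OF f'(2) k] hk by simp
    from ipb_ex [OF Ff Fg s_def hh kk this] obtain v where
      v: "iarrow B C T (iter C \<cdot> bang B T) (FO F ?P \<cdot> bang B T) v"
        "icmp B C v (ipb1 C \<cdot> s) = \<l> (Dom B f) \<cdot> h" "icmp B C v (ipb2 C \<cdot> s) = \<l> (Dom B g) \<cdot> k"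
      unfolding ip .
    obtain w where w: "w \<in> hom B T (\<box>\<^sub>o ?P)" "\<l> ?P \<cdot> w = v"
      using leg_lift [OF P v(1)] .
    have leg_p: "\<l> (Dom B f) \<cdot> (\<box>\<^sub>a ?p \<cdot> u) = icmp B C (\<l> ?P \<cdot> u) (ipb1 C \<cdot> s)"
      "\<l> (Dom B g) \<cdot> (\<box>\<^sub>a ?q \<cdot> u) = icmp B C (\<l> ?P \<cdot> u) (ipb2 C \<cdot> s)"
      if "u \<in> hom B T (\<box>\<^sub>o ?P)" for u
      using leg_box_arr [OF f'(3) that] leg_box_arr [OF f'(4) that] p q by simp_all
    show ?thesis
    proof (intro ex1I [of _ w] conjI)
      show "w \<in> hom B T (Dom B (\<box>\<^sub>a ?p))"
        using w a by simp
      show "\<box>\<^sub>a ?p \<cdot> w = h"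
        using leg_p(1) [OF w(1)] v w a f h by - (rule leg_mono [of "Dom B f" _ T], auto)
      show "\<box>\<^sub>a ?q \<cdot> w = k"
        using leg_p(2) [OF w(1)] v w a g k by - (rule leg_mono [of "Dom B g" _ T], auto)
    next
      fix u
      assume u: "u \<in> hom B T (Dom B (\<box>\<^sub>a ?p)) \<and> \<box>\<^sub>a ?p \<cdot> u = h \<and> \<box>\<^sub>a ?q \<cdot> u = k"
      then have u': "u \<in> hom B T (\<box>\<^sub>o ?P)"
        using a by simp
      have "\<l> ?P \<cdot> u = \<l> ?P \<cdot> w"
        by (rule ipb_unique [OF Ff Fg s_def, unfolded ip, OF leg_comp [OF P u'] leg_comp [OF P w(1)]])
          (use leg_p [OF u'] leg_p [OF w(1)] u v w in auto)
      then show "u = w"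
        using leg_mono [OF P u' w(1)] by simp
    qed
  qed
  note ex1 = this
  have "\<box>\<^sub>a f \<cdot> \<box>\<^sub>a ?p = \<box>\<^sub>a g \<cdot> \<box>\<^sub>a ?q"
    using a f g by (simp flip: box_comp)
  then show ?thesis
    using a f g eq unfolding is_pullback_def by (intro conjI ballI impI ex1) auto
qed

text \<open>Any pullback differs from the chosen one by an isomorphism, which the functor \<box>
  preserves.\<close>

lemma box_pullback:
  assumes pb: "is_pullback B f g p q"
  shows "is_pullback B (\<box>\<^sub>a f) (\<box>\<^sub>a g) (\<box>\<^sub>a p) (\<box>\<^sub>a q)"
proof -
  note a = pullback_arr [OF pb]
  note b = pullback_arr [OF chosen_pullback [OF a(1-3)]]
  obtain i j where i: "i \<in> Arr B" "Dom B i = Dom B p" "Cod B i = Dom B (Pb1 B f g)"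
    and j: "j \<in> Arr B" "Dom B j = Dom B (Pb1 B f g)" "Cod B j = Dom B p"
    and inv: "i \<cdot> j = Idn B (Dom B (Pb1 B f g))" "j \<cdot> i = Idn B (Dom B p)"
    and pq: "Pb1 B f g \<cdot> i = p" "Pb2 B f g \<cdot> i = q"
    by (rule chosen_pullback_iso [OF pb])
  have "\<box>\<^sub>a (i \<cdot> j) = \<box>\<^sub>a i \<cdot> \<box>\<^sub>a j" "\<box>\<^sub>a (j \<cdot> i) = \<box>\<^sub>a j \<cdot> \<box>\<^sub>a i"
    using i j by (simp_all add: box_comp)
  then have "is_pullback B (\<box>\<^sub>a f) (\<box>\<^sub>a g) (\<box>\<^sub>a (Pb1 B f g) \<cdot> \<box>\<^sub>a i) (\<box>\<^sub>a (Pb2 B f g) \<cdot> \<box>\<^sub>a i)"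
    using i j inv a b
    by (intro pullback_iso [OF box_chosen_pullback [OF a(1-3)], of _ "\<box>\<^sub>a j"]) (simp_all add: box_idn)
  moreover have "\<box>\<^sub>a (Pb1 B f g) \<cdot> \<box>\<^sub>a i = \<box>\<^sub>a (Pb1 B f g \<cdot> i)" "\<box>\<^sub>a (Pb2 B f g) \<cdot> \<box>\<^sub>a i = \<box>\<^sub>a (Pb2 B f g \<cdot> i)"
    using i b by (simp_all add: box_comp)
  ultimately show ?thesis
    by (simp add: pq)
qed

text \<open>An arrow is mono when its kernel pair consists of two identities, and this is a pullback
  condition.\<close>

lemma box_mono:
  assumes m: "mono_arr m"
  shows "mono_arr (\<box>\<^sub>a m)"
proof -
  have a: "m \<in> Arr B"
    using m by (simp add: mono_arr_def)
  have ex1: "\<exists>!w. w \<in> hom B T (Dom B m) \<and> Idn B (Dom B m) \<cdot> w = h \<and> Idn B (Dom B m) \<cdot> w = k"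
    if "h \<in> hom B T (Dom B m)" "k \<in> hom B T (Dom B m)" "m \<cdot> h = m \<cdot> k" for T h k
  proof -
    have "h = k"
      using mono_arrD [OF m that] .
    then show ?thesis
      using that(1) by (metis comp_idn(2) in_hom)
  qed
  have "is_pullback B m m (Idn B (Dom B m)) (Idn B (Dom B m))"
    using a unfolding is_pullback_def idn(2) [OF dom_cod_obj(1) [OF a]]
    by (intro conjI ballI impI ex1) auto
  note pb = box_pullback [OF this]
  have "u = v" if u: "u \<in> hom B T (\<box>\<^sub>o (Dom B m))" and v: "v \<in> hom B T (\<box>\<^sub>o (Dom B m))"
    and eq: "\<box>\<^sub>a m \<cdot> u = \<box>\<^sub>a m \<cdot> v" for T u v
  proof -
    let ?w = "mediate B (\<box>\<^sub>a (Idn B (Dom B m))) (\<box>\<^sub>a (Idn B (Dom B m))) u v"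
    have w: "?w \<in> Arr B" "Cod B ?w = \<box>\<^sub>o (Dom B m)" "Idn B (\<box>\<^sub>o (Dom B m)) \<cdot> ?w = u"
      "Idn B (\<box>\<^sub>o (Dom B m)) \<cdot> ?w = v"
      using mediate [OF pb, of u v] u v eq a by (auto simp: box_idn)
    show ?thesis
      using w(3,4) by simp
  qed
  then show ?thesis
    using a unfolding mono_arr_def by simp
qed

lemma leg_mono_arr: "A \<in> Obj B \<Longrightarrow> mono_arr (\<l> A)"
  unfolding mono_arr_def using leg_mono by simp

text \<open>\<open>F 1\<close> is the internal terminal object, so both arrows embed into
  \<open>C1 C\<close> as the same unique arrow \<open>ibang\<close>.\<close>

lemma box_one_unique:
  assumes "u \<in> hom B T (\<box>\<^sub>o (One B))" "v \<in> hom B T (\<box>\<^sub>o (One B))"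
  shows "u = v"
  using leg_mono [OF one_obj assms]
    ibang_unique [OF leg_comp [OF one_obj assms(1), unfolded F_one]]
    ibang_unique [OF leg_comp [OF one_obj assms(2), unfolded F_one]] by (simp add: F_one)

definition unit :: 'm where "unit = one_iso B B (box B C F)"

text \<open>\<open>\<box>1\<close> is the hom-object from the internal terminal object to itself;
  its only global element names the identity.\<close>

lemma unit_hom: "unit \<in> hom B (One B) (\<box>\<^sub>o (One B))"
  and leg_unit: "\<l> (One B) \<cdot> unit = iid C \<cdot> iter C"
proof -
  have "iarrow B C (One B) (iter C \<cdot> bang B (One B)) (FO F (One B) \<cdot> bang B (One B)) (iid C \<cdot> iter C)"
    using iid_iarrow [OF iter_hom] by (simp add: F_one)
  from leg_lift [OF one_obj this] obtain u
    where u: "u \<in> hom B (One B) (\<box>\<^sub>o (One B))" "\<l> (One B) \<cdot> u = iid C \<cdot> iter C" .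
  have "unit = u"
    unfolding unit_def one_iso_def using u(1) box_one_unique by (intro the_equality)
  with u show "unit \<in> hom B (One B) (\<box>\<^sub>o (One B))" "\<l> (One B) \<cdot> unit = iid C \<cdot> iter C"
    by simp_all
qed

lemma unit [simp]: "unit \<in> Arr B" "Dom B unit = One B" "Cod B unit = \<box>\<^sub>o (One B)"
  using unit_hom by simp_all

lemma box_bang:
  assumes "A \<in> Obj B" "t \<in> hom B T (\<box>\<^sub>o A)"
  shows "\<box>\<^sub>a (bang B A) \<cdot> t = unit \<cdot> bang B T"
  using assms by - (rule box_one_unique [of _ T], auto)

section \<open>The boxed internal category and the action of \<open>H\<close> on it\<close>

lemma box_icat_sel:
  "C0 \<box>\<^sub>C = \<box>\<^sub>o (C0 C)" "C1 \<box>\<^sub>C = \<box>\<^sub>o (C1 C)" "idom \<box>\<^sub>C = \<box>\<^sub>a (idom C)" "icod \<box>\<^sub>C = \<box>\<^sub>a (icod C)"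
  "cp1 \<box>\<^sub>C = \<box>\<^sub>a (cp1 C)" "cp2 \<box>\<^sub>C = \<box>\<^sub>a (cp2 C)" "icomp \<box>\<^sub>C = \<box>\<^sub>a (icomp C)"
  by (simp_all add: box_icat_def apply_icat_def)

sublocale boxed: comp_graph B "\<box>\<^sub>C"
  by unfold_locales (simp_all add: box_icat_sel box_pullback [OF cp])

lemma box_icmp:
  assumes "iarrow B C T X Y x" "iarrow B C T Y Z y" "t \<in> Arr B" "Cod B t = \<box>\<^sub>o T"
  shows "\<box>\<^sub>a (icmp B C x y) \<cdot> t = icmp B \<box>\<^sub>C (\<box>\<^sub>a x \<cdot> t) (\<box>\<^sub>a y \<cdot> t)"
proof -
  note m = iarrow_mediate [OF assms(1,2)]
  let ?m = "mediate B (cp1 C) (cp2 C) x y"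
  have "icmp B \<box>\<^sub>C (\<box>\<^sub>a x \<cdot> t) (\<box>\<^sub>a y \<cdot> t) = icomp \<box>\<^sub>C \<cdot> (\<box>\<^sub>a ?m \<cdot> t)"
    using m assms(3,4) by (intro boxed.icmp_eqI) (simp_all add: box_icat_sel box_comp_extend)
  then show ?thesis
    using m assms(3,4) by (simp add: icmp_def box_icat_sel box_comp_extend)
qed

text \<open>As \<box> preserves the pullback that defines a hom-object, an arrow of
  \<open>\<box>\<^sub>C\<close> between the images of \<open>X\<close> and \<open>Y\<close> factors
  through \<open>\<box>\<^sub>a e\<close>. This is the canonical isomorphism of hom-objects on
  generalized elements, with any pullback in the role of the hom-object.\<close>

lemma box_hom_object_lift:
  assumes XY: "X \<in> hom B (One B) (C0 C)" "Y \<in> hom B (One B) (C0 C)"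
    and pb: "is_pullback B (pair B (idom C) (icod C)) (pair B X Y) e b"
    and x: "iarrow B \<box>\<^sub>C T (\<box>\<^sub>a X \<cdot> (unit \<cdot> bang B T)) (\<box>\<^sub>a Y \<cdot> (unit \<cdot> bang B T)) x"
  shows "mediate B (\<box>\<^sub>a e) (\<box>\<^sub>a b) x (unit \<cdot> bang B T) \<in> hom B T (\<box>\<^sub>o (Dom B e))"
    and "\<box>\<^sub>a e \<cdot> mediate B (\<box>\<^sub>a e) (\<box>\<^sub>a b) x (unit \<cdot> bang B T) = x"
proof -
  note xx = boxed.iarrowD [OF x]
  let ?P = "prod1 B (C0 C) (C0 C)" and ?Q = "prod2 B (C0 C) (C0 C)"
  have x': "x \<in> Arr B" "Dom B x = T" "Cod B x = \<box>\<^sub>o (C1 C)" "T \<in> Obj B"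
    "\<box>\<^sub>a (idom C) \<cdot> x = \<box>\<^sub>a X \<cdot> (unit \<cdot> bang B T)" "\<box>\<^sub>a (icod C) \<cdot> x = \<box>\<^sub>a Y \<cdot> (unit \<cdot> bang B T)"
    using xx by (simp_all add: box_icat_sel)
  \<comment> \<open>\<box> preserves the product of \<open>C0 C\<close> with itself, so the two
    sides may be compared on the images of the projections.\<close>
  have "\<box>\<^sub>a (pair B (idom C) (icod C)) \<cdot> x = \<box>\<^sub>a (pair B X Y) \<cdot> (unit \<cdot> bang B T)"
  proof (rule pullback_eqI [OF box_pullback [OF prod_pullback [of "C0 C" "C0 C"]]])
    show "\<box>\<^sub>a ?P \<cdot> (\<box>\<^sub>a (pair B (idom C) (icod C)) \<cdot> x) = \<box>\<^sub>a ?P \<cdot> (\<box>\<^sub>a (pair B X Y) \<cdot> (unit \<cdot> bang B T))"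
      "\<box>\<^sub>a ?Q \<cdot> (\<box>\<^sub>a (pair B (idom C) (icod C)) \<cdot> x) = \<box>\<^sub>a ?Q \<cdot> (\<box>\<^sub>a (pair B X Y) \<cdot> (unit \<cdot> bang B T))"
      using XY x' by (simp_all add: box_comp_extend)
  qed (use XY x' in simp_all)
  then show "mediate B (\<box>\<^sub>a e) (\<box>\<^sub>a b) x (unit \<cdot> bang B T) \<in> hom B T (\<box>\<^sub>o (Dom B e))"
    "\<box>\<^sub>a e \<cdot> mediate B (\<box>\<^sub>a e) (\<box>\<^sub>a b) x (unit \<cdot> bang B T) = x"
    using mediate [OF box_pullback [OF pb], of x "unit \<cdot> bang B T"] x' XY pullback_arr [OF pb] by auto
qed

lemma H_arr [simp]: "H0 H \<in> Arr B" "Dom B (H0 H) = C0 C" "Cod B (H0 H) = \<box>\<^sub>o (C0 C)"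
    "H1 H \<in> Arr B" "Dom B (H1 H) = C1 C" "Cod B (H1 H) = \<box>\<^sub>o (C1 C)"
  using H_functor by (simp_all add: is_ifunctor_def box_icat_sel)

lemma H_iarrow:
  assumes "iarrow B C T X Y x"
  shows "iarrow B \<box>\<^sub>C T (H0 H \<cdot> X) (H0 H \<cdot> Y) (H1 H \<cdot> x)"
proof -
  note x = iarrowD [OF assms]
  have "idom \<box>\<^sub>C \<cdot> H1 H = H0 H \<cdot> idom C" "icod \<box>\<^sub>C \<cdot> H1 H = H0 H \<cdot> icod C"
    using H_functor by (simp_all add: is_ifunctor_def)
  then have "idom \<box>\<^sub>C \<cdot> (H1 H \<cdot> x) = H0 H \<cdot> (idom C \<cdot> x)" "icod \<box>\<^sub>C \<cdot> (H1 H \<cdot> x) = H0 H \<cdot> (icod C \<cdot> x)"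
    using x by (auto intro!: square_extend simp: box_icat_sel)
  then show ?thesis
    using x by (simp add: iarrow_def box_icat_sel)
qed

lemma H_icmp:
  assumes "iarrow B C T X Y x" "iarrow B C T Y Z y"
  shows "H1 H \<cdot> icmp B C x y = icmp B \<box>\<^sub>C (H1 H \<cdot> x) (H1 H \<cdot> y)"
proof -
  note m = iarrow_mediate [OF assms]
  let ?m = "mediate B (cp1 C) (cp2 C) x y"
  have 1: "iarrow B C (Dom B (cp1 C)) (idom C \<cdot> cp1 C) (icod C \<cdot> cp1 C) (cp1 C)"
    by (simp add: iarrow_def)
  have 2: "iarrow B C (Dom B (cp1 C)) (icod C \<cdot> cp1 C) (icod C \<cdot> cp2 C) (cp2 C)"
    using pullback_arr(9) [OF cp] by (simp add: iarrow_def)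
  have eq: "H1 H \<cdot> icomp C = icmp B \<box>\<^sub>C (H1 H \<cdot> cp1 C) (H1 H \<cdot> cp2 C)"
    using H_functor by (simp add: is_ifunctor_def)
  have "H1 H \<cdot> (icomp C \<cdot> ?m) = icmp B \<box>\<^sub>C (H1 H \<cdot> cp1 C) (H1 H \<cdot> cp2 C) \<cdot> ?m"
    using m by (intro comp_extend [OF eq]) auto
  then show ?thesis
    using boxed.icmp_comp [OF H_iarrow [OF 1] H_iarrow [OF 2], of ?m] m by (simp add: icmp_def)
qed

section \<open>Codes of global elements and quotation\<close>

lemma H_F_obj: "A \<in> Obj B \<Longrightarrow> H0 H \<cdot> FO F A = \<box>\<^sub>a (FO F A) \<cdot> unit"
  and H_F_arr: "f \<in> Arr B \<Longrightarrow> H1 H \<cdot> FA F f = \<box>\<^sub>a (FA F f) \<cdot> unit"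
  using H_F by (simp_all add: functor_eq_def functor_comp_def Gam_functor_def sharp_def unit_def)

lemma H_F_obj_bang:
  assumes "A \<in> Obj B" "T \<in> Obj B"
  shows "H0 H \<cdot> (FO F A \<cdot> bang B T) = \<box>\<^sub>a (FO F A) \<cdot> (unit \<cdot> bang B T)"
  using assms by (intro square_extend H_F_obj) auto

lemma H_F_arr_bang:
  assumes "f \<in> Arr B" "T \<in> Obj B"
  shows "H1 H \<cdot> (FA F f \<cdot> bang B T) = \<box>\<^sub>a (FA F f) \<cdot> (unit \<cdot> bang B T)"
  using assms by (intro square_extend H_F_arr) auto

text \<open>\<open>unit\<close> names the identity of the internal terminal object, so composing it
  with \<open>F f\<close> leaves \<open>F f\<close>. At \<open>f = FA F p\<close> and with
  \<open>H_F_arr\<close>, the code of \<open>F p\<close> under \<open>H\<close> is thus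
  \<open>F (F p)\<close>.\<close>

lemma leg_H_F:
  assumes f: "f \<in> Arr B" and d: "Dom B f = One B"
  shows "\<l> (Cod B f) \<cdot> (\<box>\<^sub>a f \<cdot> unit) = FA F f"
proof -
  have "\<l> (Cod B f) \<cdot> (\<box>\<^sub>a f \<cdot> unit) = icmp B C (\<l> (One B) \<cdot> unit) (FA F f \<cdot> bang B (One B))"
    using f d by (intro leg_box_arr) auto
  also have "\<dots> = FA F f"
    unfolding leg_unit using iid_icmp [OF F_arr [OF f]] f d by (simp add: F_one)
  finally show ?thesis .
qed

text \<open>The leg is mono and stays so under \<box>, hence the equation determines
  \<open>\<sigma> A\<close>: quotation is \<open>H\<close> once the canonical isomorphism is
  absorbed.\<close>

lemma sigma:
  assumes A: "A \<in> Obj B"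
  shows "\<sigma> A \<in> hom B (\<box>\<^sub>o A) (\<box>\<^sub>o (\<box>\<^sub>o A))" and "\<box>\<^sub>a (\<l> A) \<cdot> \<sigma> A = H1 H \<cdot> \<l> A"
proof -
  let ?X = "H0 H \<cdot> iter C" and ?Y = "H0 H \<cdot> FO F A"
  let ?L = "hom_leg1 B \<box>\<^sub>C ?X ?Y" and ?E = "hom_obj B \<box>\<^sub>C ?X ?Y"
  have XY: "?X \<in> hom B (One B) (C0 \<box>\<^sub>C)" "?Y \<in> hom B (One B) (C0 \<box>\<^sub>C)"
    using A by (simp_all add: box_icat_sel)
  \<comment> \<open>These equations identify the ends reached by \<open>H\<close> with those
    obtained from \<box>, so that the canonical isomorphism starts where \<open>hom_map\<close>
    ends.\<close>
  have X: "\<box>\<^sub>a (iter C) \<cdot> unit = ?X" and Y: "\<box>\<^sub>a (FO F A) \<cdot> unit = ?Y"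
    using H_F_obj [OF one_obj] H_F_obj [OF A] by (simp_all add: F_one)
  note L = boxed.hom_leg [OF XY]
  have E: "?E \<in> Obj B"
    using boxed.iarrowD(6) [OF L(1)] .
  have pb: "is_pullback B (pair B (idom C) (icod C)) (pair B (iter C) (FO F A)) (\<l> A) (hom_leg2 B C (iter C) (FO F A))"
    using hom_pullback [OF iter_hom F_hom [OF A]] .
  let ?m = "mediate B (\<box>\<^sub>a (\<l> A)) (\<box>\<^sub>a (hom_leg2 B C (iter C) (FO F A))) ?L (unit \<cdot> bang B ?E)"
  have "iarrow B \<box>\<^sub>C ?E (\<box>\<^sub>a (iter C) \<cdot> (unit \<cdot> bang B ?E)) (\<box>\<^sub>a (FO F A) \<cdot> (unit \<cdot> bang B ?E)) ?L"
    using L(1) A E unfolding X [symmetric] Y [symmetric] by simp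
  note m = box_hom_object_lift [OF iter_hom F_hom [OF A] pb this]
  have iso: "hom_iso B B (box B C F) C (iter C) (FO F A) = ?m"
    unfolding hom_iso_def Let_def sharp_def
    by (simp add: X Y L(2) flip: unit_def box_icat_def)
  have "iarrow B \<box>\<^sub>C (\<box>\<^sub>o A) (?X \<cdot> bang B (\<box>\<^sub>o A)) (?Y \<cdot> bang B (\<box>\<^sub>o A)) (H1 H \<cdot> \<l> A)"
    using H_iarrow [OF leg_iarrow [OF A]] A by simp
  note h = boxed.hom_lift [OF XY this, folded hom_map_def]
  have q: "\<sigma> A = ?m \<cdot> hom_map B C \<box>\<^sub>C H (iter C) (FO F A)"
    unfolding box_quote_def iso ..
  show "\<sigma> A \<in> hom B (\<box>\<^sub>o A) (\<box>\<^sub>o (\<box>\<^sub>o A))"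
    unfolding q using h m A by simp
  show "\<box>\<^sub>a (\<l> A) \<cdot> \<sigma> A = H1 H \<cdot> \<l> A"
    unfolding q using h m A comp_extend [OF m(2), of "hom_map B C \<box>\<^sub>C H (iter C) (FO F A)"] by simp
qed

lemma sigma_arr [simp]:
  assumes "A \<in> Obj B"
  shows "\<sigma> A \<in> Arr B" "Dom B (\<sigma> A) = \<box>\<^sub>o A" "Cod B (\<sigma> A) = \<box>\<^sub>o (\<box>\<^sub>o A)"
  using sigma(1) [OF assms] by simp_all

text \<open>\<open>\<box>\<^sub>a f\<close> composes with the constant \<open>F f\<close>;
  \<open>H\<close> preserves composition and agrees with \<box> on that constant.\<close>

lemma sigma_natural:
  assumes f: "f \<in> Arr B"
  shows "\<box>\<^sub>a (\<box>\<^sub>a f) \<cdot> \<sigma> (Dom B f) = \<sigma> (Cod B f) \<cdot> \<box>\<^sub>a f"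
proof -
  let ?A = "Dom B f" and ?A' = "Cod B f"
  let ?S = "\<box>\<^sub>o ?A"
  have o: "?A \<in> Obj B" "?A' \<in> Obj B" "?S \<in> Obj B"
    using f by auto
  have const: "\<box>\<^sub>a (FA F f \<cdot> bang B ?S) \<cdot> \<sigma> ?A = H1 H \<cdot> (FA F f \<cdot> bang B ?S)"
  proof -
    have "\<box>\<^sub>a (FA F f \<cdot> bang B ?S) \<cdot> \<sigma> ?A = \<box>\<^sub>a (FA F f) \<cdot> (\<box>\<^sub>a (bang B ?S) \<cdot> \<sigma> ?A)"
      using f o by (simp add: box_comp)
    also have "\<dots> = \<box>\<^sub>a (FA F f) \<cdot> (unit \<cdot> bang B ?S)"
      using box_bang [of ?S "\<sigma> ?A" ?S] o by simp
    finally show ?thesis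
      using H_F_arr_bang f o by simp
  qed
  have "\<box>\<^sub>a (\<l> ?A') \<cdot> (\<box>\<^sub>a (\<box>\<^sub>a f) \<cdot> \<sigma> ?A) = \<box>\<^sub>a (icmp B C (\<l> ?A) (FA F f \<cdot> bang B ?S)) \<cdot> \<sigma> ?A"
    using f o by (simp add: box_comp_extend box_arr_leg(2))
  also have "\<dots> = icmp B \<box>\<^sub>C (\<box>\<^sub>a (\<l> ?A) \<cdot> \<sigma> ?A) (\<box>\<^sub>a (FA F f \<cdot> bang B ?S) \<cdot> \<sigma> ?A)"
    using o by (intro box_icmp [OF leg_iarrow [OF o(1)] F_const [OF f o(3)]]) auto
  also have "\<dots> = icmp B \<box>\<^sub>C (H1 H \<cdot> \<l> ?A) (H1 H \<cdot> (FA F f \<cdot> bang B ?S))"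
    using sigma(2) [OF o(1)] const by simp
  also have "\<dots> = H1 H \<cdot> (\<l> ?A' \<cdot> \<box>\<^sub>a f)"
    using H_icmp [OF leg_iarrow [OF o(1)] F_const [OF f o(3)]] box_arr_leg(2) [OF f] by simp
  also have "\<dots> = \<box>\<^sub>a (\<l> ?A') \<cdot> (\<sigma> ?A' \<cdot> \<box>\<^sub>a f)"
    using f o by (intro square_extend sigma(2) [symmetric]) auto
  finally show ?thesis
    using f o by - (rule mono_arrD [OF box_mono [OF leg_mono_arr [OF o(2)]], of _ ?S], auto)
qed


section \<open>Diagonalization\<close>

text \<open>
  The object \<open>P\<close> consists of the pairs of an arrow \<open>m\<close> of \<open>\<C>\<close> into \<open>F C1\<close> and an arrow
  \<open>\<delta> m \<rightarrow> F A\<close>, where \<open>\<delta> m\<close> is the fibre of \<open>m\<close> over its own code \<open>\<H> m\<close>. The fibre \<open>D\<close> of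
  \<open>P\<close> over \<open>F p\<close>, where \<open>p\<close> is the projection \<open>(m, _) \<mapsto> m\<close>, is the hom-object
  \<open>\<C>(\<delta> (F p), F A)\<close>. Since \<open>\<H> (F p) = F (F p)\<close>, the functor \<open>F\<close> maps the pullback that defines
  \<open>D\<close> to the one that defines \<open>\<delta> (F p)\<close>, whence \<open>\<delta> (F p) = F D\<close>.
\<close>

lemma diagonal_object:
  assumes A: "A \<in> Obj B"
  obtains D e where "D \<in> Obj B" "Dom B e = D"
    "is_pullback B (pair B (idom C) (icod C)) (pair B (FO F D) (FO F A)) e (bang B D)"
proof -
  let ?c = "FO F (C1 C)"
  \<comment> \<open>\<open>M\<close> is the object of internal arrows with codomain
    \<open>F C1\<close>.\<close>
  define n where "n = Pb1 B (icod C) ?c"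
  define M where "M = Dom B n"
  have pn: "is_pullback B (icod C) ?c n (Pb2 B (icod C) ?c)"
    unfolding n_def by (intro chosen_pullback) auto
  have n: "n \<in> Arr B" "Dom B n = M" "Cod B n = C1 C" and M: "M \<in> Obj B"
    using pullback_arr [OF pn] by (auto simp: M_def)
  have b: "Pb2 B (icod C) ?c = bang B M"
    using bang_unique [of "Pb2 B (icod C) ?c"] pullback_arr [OF pn] by (simp add: M_def)
  note pn = pn [unfolded b]
  have n_mono: "mono_arr n"
    unfolding mono_arr_def
  proof (intro conjI allI impI)
    fix T u v
    assume "u \<in> hom B T (Dom B n)" "v \<in> hom B T (Dom B n)" "n \<cdot> u = n \<cdot> v"
    then show "u = v"
      using M n by - (rule pullback_eqI [OF pn], simp_all)
  qed (rule n(1))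
  have n_arr: "iarrow B C M (idom C \<cdot> n) (?c \<cdot> bang B M) n"
    using pullback_arr(9) [OF pn] n by (simp add: iarrow_def)
  \<comment> \<open>\<open>H1 H \<cdot> n\<close> ends in \<open>\<box>C1\<close>, the hom-object
    from \<open>1\<close> to \<open>F C1\<close>. The code of an arrow in \<open>M\<close> is thus
    again an arrow into \<open>F C1\<close> and forms a cospan with it, whose chosen pullback has
    apex \<delta>.\<close>
  have h_arr: "iarrow B C M (iter C \<cdot> bang B M) (?c \<cdot> bang B M) (\<l> (C1 C) \<cdot> (H1 H \<cdot> n))"
    using n by (intro leg_comp) auto
  define s where "s = mediate B (cs1 C) (cs2 C) n (\<l> (C1 C) \<cdot> (H1 H \<cdot> n))"
  note s = cospan [OF n_arr h_arr, folded s_def]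
  define \<delta> where "\<delta> = idom C \<cdot> (ipb1 C \<cdot> s)"
  have \<delta>: "\<delta> \<in> Arr B" "Dom B \<delta> = M" "Cod B \<delta> = C0 C"
    using s by (simp_all add: \<delta>_def)
  let ?g = "pair B \<delta> (FO F A \<cdot> bang B M)"
  let ?f = "pair B (idom C) (icod C)"
  \<comment> \<open>The hom-objects from \<delta> to \<open>F A\<close> form a family over
    \<open>M\<close>: \<open>x\<close> is the arrow, \<open>y\<close> its index, and
    \<open>p\<close> regards the index as an element of \<open>C1 C\<close>.\<close>
  define x where "x = Pb1 B ?f ?g"
  define y where "y = Pb2 B ?f ?g"
  have xy: "is_pullback B ?f ?g x y"
    unfolding x_def y_def using \<delta> A M by (intro chosen_pullback) auto
  have y: "y \<in> Arr B" "Cod B y = M"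
    using pullback_arr [OF xy] \<delta> A M by auto
  define p where "p = n \<cdot> y"
  have p: "p \<in> Arr B" "Cod B p = C1 C" "Dom B p = Dom B y"
    unfolding p_def using n y by simp_all
  let ?Fp = "FA F p"
  define c where "c = Pb1 B p ?Fp"
  define D where "D = Dom B c"
  have pc: "is_pullback B p ?Fp c (Pb2 B p ?Fp)"
    unfolding c_def using p by (intro chosen_pullback) auto
  have c: "c \<in> Arr B" "Dom B c = D" "Cod B c = Dom B y" and D: "D \<in> Obj B"
    using pullback_arr [OF pc] p by (auto simp: D_def)
  have "Pb2 B p ?Fp = bang B D"
    using bang_unique [of "Pb2 B p ?Fp"] pullback_arr [OF pc] p by (simp add: D_def)
  note pc = pc [unfolded this]
  \<comment> \<open>As \<open>p\<close> ends in \<open>C1 C\<close>, its image \<open>F p\<close>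
    ends in \<open>F C1\<close> and is a point of \<open>M\<close>: the family is evaluated at its
    own index map.\<close>
  define m where "m = mediate B n (bang B M) ?Fp (Idn B (One B))"
  have m: "m \<in> Arr B" "Dom B m = One B" "Cod B m = M" "n \<cdot> m = ?Fp"
    unfolding m_def M_def using mediate [OF pn, of ?Fp "Idn B (One B)"] p by (auto simp: M_def)
  have h: "(\<l> (C1 C) \<cdot> (H1 H \<cdot> n)) \<cdot> m = FA F ?Fp"
    using leg_H_F [of ?Fp] H_F_arr [OF p(1)] n m p by simp
  have "s \<cdot> m = mediate B (cs1 C) (cs2 C) ?Fp (FA F ?Fp)"
    using cospan_comp [OF n_arr h_arr m(1,3)] h m(4) by (simp add: s_def)
  \<comment> \<open>The cospan at \<open>m\<close> is the image under \<open>F\<close> of the cospan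
    of \<open>p\<close> and \<open>F p\<close> in \<open>B\<close>. Strict preservation takes
    \<open>c\<close> to the internal leg, so the apex at \<open>m\<close> equals
    \<open>F D\<close>.\<close>
  then have "ipb1 C \<cdot> (s \<cdot> m) = FA F c"
    unfolding c_def using F_pb(1) [of p ?Fp] p by simp
  then have \<delta>m: "\<delta> \<cdot> m = FO F D"
    using s m c by (simp add: \<delta>_def)
  \<comment> \<open>The fibre of \<open>p\<close> over \<open>F p\<close> is the fibre of
    \<open>y\<close> over \<open>m\<close>, because \<open>n\<close> is mono; pasting makes it the
    hom-object at \<open>m\<close>.\<close>
  have "is_pullback B y m c (bang B D)"
    using pullback_cancel_mono [OF n_mono, of y "Dom B y" m "One B" c "bang B D"] pc n y m
    by (simp add: p_def)
  from pullback_paste [OF xy this]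
  have "is_pullback B ?f (?g \<cdot> m) (x \<cdot> c) (bang B D)" .
  moreover have "?g \<cdot> m = pair B (FO F D) (FO F A)"
    using pair_comp [of \<delta> "FO F A \<cdot> bang B M" m] \<delta> A M m \<delta>m by simp
  moreover have "Dom B (x \<cdot> c) = D"
    using pullback_arr [OF xy] c by simp
  ultimately show ?thesis
    using that D by metis
qed

end


section \<open>The fixed point\<close>

locale geminal_cat =
  fixes B :: "('o, 'm, 'z) fl_category_scheme" (structure) and C :: "('o, 'm) fl_icat"
    and F :: "('o, 'm, 'm, 'm) functr" and H :: "'m ifunctor"
  assumes geminal: "geminal B C F H"
begin

sublocale pre_geminal_cat B C F H
  using geminal by unfold_locales (simp_all add: geminal_def pre_geminal_def)

lemma box_H_H: "\<box>\<^sub>a (H1 H) \<cdot> H1 H = \<sigma> (C1 C) \<cdot> H1 H"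
  using geminal by (simp add: geminal_def ifunctor_comp_def apply_ifunctor_def isharp_def)

theorem fixed_point:
  assumes A: "A \<in> Obj B"
  defines "K \<equiv> hom_obj B C (FO F (\<box>\<^sub>o A)) (FO F A)"
  shows "\<exists>Y \<in> hom B K (\<box>\<^sub>o A).
    Y = hom_comp B C (iter C) (FO F (\<box>\<^sub>o A)) (FO F A) \<cdot> pair B (\<sigma> A \<cdot> Y) (Idn B K)"
proof -
  let ?\<kappa> = "hom_leg1 B C (FO F (\<box>\<^sub>o A)) (FO F A)"
  obtain D e where D: "D \<in> Obj B" and Dom_e: "Dom B e = D"
    and pb: "is_pullback B (pair B (idom C) (icod C)) (pair B (FO F D) (FO F A)) e (bang B D)"
    using diagonal_object [OF A] .
  have FD: "FO F D \<in> hom B (One B) (C0 C)" and FA: "FO F A \<in> hom B (One B) (C0 C)"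
    and FBA: "FO F (\<box>\<^sub>o A) \<in> hom B (One B) (C0 C)"
    using A D by auto
  have e_arr: "iarrow B C D (FO F D \<cdot> bang B D) (FO F A \<cdot> bang B D) e"
    using hom_object_iarrow(2) [OF FD FA pb] Dom_e by simp
  note e = iarrowD(1-3) [OF e_arr]
  have "mono_arr e"
    unfolding mono_arr_def using e hom_object_mono [OF FD FA pb] by blast
  note ee_mono = box_mono [OF box_mono [OF this]]

  \<comment> \<open>Quotation on \<open>D\<close>: \<open>H\<close> acts on the arrow from
    \<open>F D\<close> to \<open>F A\<close> that \<open>e\<close> gives, and the result is factored
    through \<open>\<box>\<^sub>a e\<close>.\<close>
  define h where "h = mediate B (\<box>\<^sub>a e) (\<box>\<^sub>a (bang B D)) (H1 H \<cdot> e) (unit \<cdot> bang B D)"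
  have "iarrow B \<box>\<^sub>C D (\<box>\<^sub>a (FO F D) \<cdot> (unit \<cdot> bang B D)) (\<box>\<^sub>a (FO F A) \<cdot> (unit \<cdot> bang B D)) (H1 H \<cdot> e)"
    using H_iarrow [OF e_arr] H_F_obj_bang D A by simp
  note h = box_hom_object_lift [OF FD FA pb this, folded h_def, unfolded Dom_e]
  have h': "h \<in> Arr B" "Dom B h = D" "Cod B h = \<box>\<^sub>o D"
    using h(1) by simp_all
  note lh = leg_comp [OF D h(1)]
  \<comment> \<open>Self-application: the code of an element of \<open>D\<close> is an arrow from
    \<open>1\<close> to \<open>F D\<close>, which is composed with the arrow from \<open>F D\<close>
    to \<open>F A\<close> that the element represents.\<close>
  obtain s where s: "s \<in> hom B D (\<box>\<^sub>o A)" and leg_s: "\<l> A \<cdot> s = icmp B C (\<l> D \<cdot> h) e"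
    using leg_lift [OF A icmp_iarrow [OF lh e_arr]] .
  have s': "s \<in> Arr B" "Dom B s = D" "Cod B s = \<box>\<^sub>o A"
    using s by simp_all

  \<comment> \<open>Quoting a code in two ways: under the mono
    \<open>\<box>\<^sub>a (\<box>\<^sub>a e)\<close> one side applies \<box> of \<open>H\<close>
    after \<open>H\<close>, the other quotation after \<open>H\<close>. The geminal equation
    identifies them, and naturality of \<sigma> at \<open>e\<close> brings the second back to
    \<open>D\<close>.\<close>
  have hh: "\<box>\<^sub>a h \<cdot> h = \<sigma> D \<cdot> h"
  proof (rule mono_arrD [OF ee_mono, of _ D])
    have "\<box>\<^sub>a (\<box>\<^sub>a e) \<cdot> (\<box>\<^sub>a h \<cdot> h) = \<box>\<^sub>a (H1 H \<cdot> e) \<cdot> h"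
      using e h' h(2) by (simp add: box_comp_extend)
    also have "\<dots> = \<box>\<^sub>a (H1 H) \<cdot> (\<box>\<^sub>a e \<cdot> h)"
      using e h' by (simp add: box_comp)
    also have "\<dots> = \<sigma> (C1 C) \<cdot> (H1 H \<cdot> e)"
      unfolding h(2) using e by (intro square_extend box_H_H) auto
    also have "\<dots> = \<sigma> (C1 C) \<cdot> (\<box>\<^sub>a e \<cdot> h)"
      unfolding h(2) ..
    also have "\<dots> = \<box>\<^sub>a (\<box>\<^sub>a e) \<cdot> (\<sigma> D \<cdot> h)"
      using sigma_natural [OF e(1)] e h' D by (intro square_extend) auto
    finally show "\<box>\<^sub>a (\<box>\<^sub>a e) \<cdot> (\<box>\<^sub>a h \<cdot> h) = \<box>\<^sub>a (\<box>\<^sub>a e) \<cdot> (\<sigma> D \<cdot> h)" .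
  qed (use e h' D in auto)
  have "\<box>\<^sub>a (\<l> D \<cdot> h) \<cdot> h = \<box>\<^sub>a (\<l> D) \<cdot> (\<box>\<^sub>a h \<cdot> h)"
    using h' D by (simp add: box_comp)
  also have "\<dots> = H1 H \<cdot> (\<l> D \<cdot> h)"
    unfolding hh using h' D by (intro square_extend sigma) auto
  finally have lhh: "\<box>\<^sub>a (\<l> D \<cdot> h) \<cdot> h = H1 H \<cdot> (\<l> D \<cdot> h)" .
  \<comment> \<open>This says \<open>F s \<circ> \<H> d = \<H> (s d)\<close>: \<open>H\<close>
    preserves the composite that defines \<open>s\<close>, with \<open>lhh\<close> treating the code
    and \<open>h(2)\<close> the arrow applied to it.\<close>
  have sh: "\<box>\<^sub>a s \<cdot> h = \<sigma> A \<cdot> s"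
  proof (rule mono_arrD [OF box_mono [OF leg_mono_arr [OF A]], of _ D])
    have "\<box>\<^sub>a (\<l> A) \<cdot> (\<box>\<^sub>a s \<cdot> h) = \<box>\<^sub>a (icmp B C (\<l> D \<cdot> h) e) \<cdot> h"
      using s' h' A by (simp add: box_comp_extend leg_s)
    also have "\<dots> = icmp B \<box>\<^sub>C (\<box>\<^sub>a (\<l> D \<cdot> h) \<cdot> h) (\<box>\<^sub>a e \<cdot> h)"
      using h' by (intro box_icmp [OF lh e_arr])
    also have "\<dots> = H1 H \<cdot> (\<l> A \<cdot> s)"
      unfolding lhh h(2) leg_s using H_icmp [OF lh e_arr] by simp
    also have "\<dots> = \<box>\<^sub>a (\<l> A) \<cdot> (\<sigma> A \<cdot> s)"
      using s' A by (intro square_extend sigma(2) [symmetric]) auto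
    finally show "\<box>\<^sub>a (\<l> A) \<cdot> (\<box>\<^sub>a s \<cdot> h) = \<box>\<^sub>a (\<l> A) \<cdot> (\<sigma> A \<cdot> s)" .
  qed (use s' h' A in auto)

  have \<kappa>: "iarrow B C K (FO F (\<box>\<^sub>o A) \<cdot> bang B K) (FO F A \<cdot> bang B K) ?\<kappa>"
    unfolding K_def using hom_leg(1) [OF FBA FA] .
  note K = iarrowD(6) [OF \<kappa>]
  have Fs: "iarrow B C K (FO F D \<cdot> bang B K) (FO F (\<box>\<^sub>o A) \<cdot> bang B K) (FA F s \<cdot> bang B K)"
    using F_const [OF s'(1) K] s' by simp
  note x = icmp_iarrow [OF Fs \<kappa>]
  \<comment> \<open>\<open>F s\<close> followed by the generic arrow from \<open>F \<box>A\<close>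
    to \<open>F A\<close> starts at \<open>F D\<close>, so it is represented by an element of
    \<open>D\<close> at stage \<open>K\<close>.\<close>
  define d where "d = mediate B e (bang B D) (icmp B C (FA F s \<cdot> bang B K) ?\<kappa>) (bang B K)"
  have d: "d \<in> Arr B" "Dom B d = K" "Cod B d = D" "e \<cdot> d = icmp B C (FA F s \<cdot> bang B K) ?\<kappa>"
    unfolding d_def
    using mediate [OF pb iarrowD(1) [OF x], of "bang B K"] iarrowD(1-3) [OF x]
      hom_object_square [OF FD FA x] K D A Dom_e by auto
  let ?Y = "s \<cdot> d"
  let ?R = "hom_comp B C (iter C) (FO F (\<box>\<^sub>o A)) (FO F A) \<cdot> pair B (\<sigma> A \<cdot> ?Y) (Idn B K)"
  have Y: "?Y \<in> hom B K (\<box>\<^sub>o A)"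
    using s' d by simp
  have u: "\<sigma> A \<cdot> ?Y \<in> hom B K (hom_obj B C (iter C) (FO F (\<box>\<^sub>o A)))"
    using Y A by (simp flip: box_obj_hom)
  have v: "Idn B K \<in> hom B K (hom_obj B C (FO F (\<box>\<^sub>o A)) (FO F A))"
    using K by (simp add: K_def)
  note R = hom_comp [OF iter_hom FBA FA u v]
  have hd: "h \<cdot> d \<in> hom B K (\<box>\<^sub>o D)"
    using h' d by simp
  have "\<l> A \<cdot> ?Y = icmp B C (\<l> D \<cdot> h) e \<cdot> d"
    using leg_s s' d A by (intro comp_extend) auto
  also have "\<dots> = icmp B C (\<l> D \<cdot> (h \<cdot> d)) (icmp B C (FA F s \<cdot> bang B K) ?\<kappa>)"
    using icmp_comp [OF lh e_arr d(1,3)] d h' D by simp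
  \<comment> \<open>Reassociating isolates the code of \<open>d\<close> followed by
    \<open>F s\<close>, which is the action of \<open>\<box>\<^sub>a s\<close> on that code and
    hence, by \<open>sh\<close>, the quotation of \<open>?Y\<close>.\<close>
  also have "\<dots> = icmp B C (icmp B C (\<l> D \<cdot> (h \<cdot> d)) (FA F s \<cdot> bang B K)) ?\<kappa>"
    by (rule icmp_assoc [OF leg_comp [OF D hd] Fs \<kappa>, symmetric])
  also have "icmp B C (\<l> D \<cdot> (h \<cdot> d)) (FA F s \<cdot> bang B K) = \<l> (\<box>\<^sub>o A) \<cdot> (\<box>\<^sub>a s \<cdot> (h \<cdot> d))"
    by (rule leg_box_arr [OF s hd, symmetric])
  also have "\<box>\<^sub>a s \<cdot> (h \<cdot> d) = \<sigma> A \<cdot> ?Y"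
    using s' h' d A by (intro square_extend sh) auto
  also have "icmp B C (\<l> (\<box>\<^sub>o A) \<cdot> (\<sigma> A \<cdot> ?Y)) ?\<kappa> = \<l> A \<cdot> ?R"
    unfolding R(2) using iarrowD(1-2) [OF \<kappa>] by simp
  finally have "\<l> A \<cdot> ?Y = \<l> A \<cdot> ?R" .
  then have "?Y = ?R"
    using leg_mono [OF A Y, of ?R] R(1) by (simp add: box_obj_hom)
  with Y show ?thesis
    by blast
qed

end

theorem theorem6p11:
  fixes B :: "('o, 'm) fl_category"
    and C :: "('o, 'm) fl_icat"
    and F :: "('o, 'm, 'm, 'm) functr"
    and H :: "'m ifunctor"
    and A :: 'o
  assumes "geminal B C F H"
    and "A \<in> Obj B"
  shows "let BA = FO (box B C F) A; K = hom_obj B C (FO F BA) (FO F A) in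
    \<exists>Y \<in> hom B K BA.
      Y = hom_comp B C (iter C) (FO F BA) (FO F A) \<cdot>\<^bsub>B\<^esub>
            pair B (box_quote B C F H A \<cdot>\<^bsub>B\<^esub> Y) (Idn B K)"
proof -
  interpret geminal_cat B C F H
    using assms(1) by unfold_locales
  show ?thesis
    unfolding Let_def using fixed_point [OF assms(2)] .
qed

end
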